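(* Let $q=2$, $m\geq 6$, $n=2^m-1$, and $2\le\delta\le n$. Then $\mathcal{C}_{(2,n,\delta,2)}$ is a dually-BCH code if and only if $$\delta=2\quad\text{or}\quad 2^{m-1}-2^{\lfloor \frac{m-1}{2}\rfloor}-1\leq \delta\leq n-1.$$
   Context: Let $\alpha$ be a generator of $\mathbb{F}_{2^m}^*$; it is a primitive $n$-th root of unity for $n=2^m-1$. For an integer $j$ (read modulo $n$) let $m_j(x)$ be the minimal polynomial of $\alpha^j$ over $\mathbb{F}_2$. For integers $b\ge 1$ and $2\le\delta\le n$, the BCH code $\mathcal{C}_{(2,n,\delta,b)}$ with respect to $\alpha$ is the cyclic code of length $n$ over $\mathbb{F}_2$ (an ideal of $\mathbb{F}_2[x]/\langle x^n-1\rangle$) generated by $\mathrm{lcm}(m_b(x),m_{b+1}(x),\dots,m_{b+\delta-2}(x))$. A BCH code is called dually-BCH if its dual code (with respect to the standard inner product) is again a BCH code $\mathcal{C}_{(2,n,\delta',b')}$ with respect to the same primitive $n$-th root of unity, for some $b'$ and $\delta'$. *)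

theory Defs
  imports
    "HOL-Library.Cardinality"
    "HOL-Library.Z2"
    "HOL-Computational_Algebra.Computational_Algebra"
    "HOL-Computational_Algebra.Field_as_Ring"
begin

text \<open>
  The field of two elements is \<^typ>\<open>bit\<close>. The library provides \<^const>\<open>Lcm\<close> on
  \<^typ>\<open>bit poly\<close> once \<^typ>\<open>bit\<close> is an instance of \<^class>\<open>field_gcd\<close>.
\<close>

instantiation bit ::
  "{unique_euclidean_ring, normalization_euclidean_semiring, normalization_semidom_multiplicative}"
begin

definition [simp]: "normalize_bit = (normalize_field :: bit \<Rightarrow> _)"
definition [simp]: "unit_factor_bit = (unit_factor_field :: bit \<Rightarrow> _)"
definition [simp]: "euclidean_size_bit = (euclidean_size_field :: bit \<Rightarrow> _)"
definition [simp]: "division_segment (x :: bit) = 1"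

instance
  by standard
    (auto simp: dvd_field_iff field_split_simps split: if_splits)

end

instantiation bit :: euclidean_ring_gcd
begin

definition gcd_bit :: "bit \<Rightarrow> bit \<Rightarrow> bit" where
  "gcd_bit = Euclidean_Algorithm.gcd"
definition lcm_bit :: "bit \<Rightarrow> bit \<Rightarrow> bit" where
  "lcm_bit = Euclidean_Algorithm.lcm"
definition Gcd_bit :: "bit set \<Rightarrow> bit" where
  "Gcd_bit = Euclidean_Algorithm.Gcd"
definition Lcm_bit :: "bit set \<Rightarrow> bit" where
  "Lcm_bit = Euclidean_Algorithm.Lcm"

instance
  by standard (simp_all add: gcd_bit_def lcm_bit_def Gcd_bit_def Lcm_bit_def)

end

instance bit :: field_gcd ..

text \<open>
  The map \<^term>\<open>of_bit :: bit \<Rightarrow> 'a::field\<close> sends \<open>0\<close> to \<open>0\<close> and \<open>1\<close> to \<open>1\<close>; it is the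
  embedding of the prime field whenever \<open>'a\<close> has characteristic 2.
\<close>

definition is_min_poly :: "'a::field \<Rightarrow> bit poly \<Rightarrow> bool" where
  "is_min_poly x p \<longleftrightarrow>
     lead_coeff p = 1 \<and> poly (map_poly of_bit p) x = 0 \<and>
     (\<forall>q. q \<noteq> 0 \<and> poly (map_poly of_bit q) x = 0 \<longrightarrow> degree p \<le> degree q)"

definition min_poly :: "'a::field \<Rightarrow> bit poly" where
  "min_poly x = (THE p. is_min_poly x p)"

lemma of_bit_add:
  assumes "CHAR('a::field) = 2"
  shows "(of_bit (a + b) :: 'a) = of_bit a + of_bit b"
proof -
  have "(1 + 1 :: 'a) = 0"
    using of_nat_CHAR[where ?'a = 'a] assms by simp
  then show ?thesis by (cases a; cases b) auto
qed

lemma poly_of_bit_add: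
  assumes "CHAR('a::field) = 2"
  shows "poly (map_poly of_bit (p + q)) (x :: 'a) =
           poly (map_poly of_bit p) x + poly (map_poly of_bit q) x"
proof -
  have "map_poly of_bit (p + q) = map_poly of_bit p + (map_poly of_bit q :: 'a poly)"
    by (rule poly_eqI) (simp only: coeff_map_poly coeff_add of_bit_add[OF assms] even_zero
          of_bool_eq simp_thms)
  then show ?thesis by simp
qed

lemma is_min_poly_min_poly:
  fixes x :: "'a::{field,finite}"
  assumes char: "CHAR('a) = 2"
  shows "is_min_poly x (min_poly x)"
proof -
  define R where "R = (\<lambda>p. p \<noteq> 0 \<and> poly (map_poly of_bit p) x = 0)"
  have "\<not> inj (\<lambda>k::nat. x ^ k)"
    using finite_imageD[of "\<lambda>k::nat. x ^ k" UNIV] by auto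
  then obtain i j :: nat where ij: "i \<noteq> j" "x ^ i = x ^ j"
    by (auto simp: inj_on_def)
  have two: "(1 + 1 :: 'a) = 0"
    using of_nat_CHAR[where ?'a = 'a] char by simp
  have xx: "x ^ j + x ^ j = 0"
    using two by (metis mult_2 mult_zero_left one_add_one)
  have "monom 1 i + monom 1 j \<noteq> (0 :: bit poly)"
  proof
    assume "monom 1 i + monom 1 j = (0 :: bit poly)"
    then have "coeff (monom 1 i + monom 1 j :: bit poly) i = 0" by simp
    with ij(1) show False by simp
  qed
  moreover have "poly (map_poly of_bit (monom 1 i + monom 1 j)) x = 0"
    unfolding poly_of_bit_add[OF char] using ij(2) xx by (simp add: map_poly_monom poly_monom)
  ultimately have "R (monom 1 i + monom 1 j)" by (simp add: R_def)
  then obtain p where p: "R p" "\<And>q. R q \<Longrightarrow> degree p \<le> degree q"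
    using ex_has_least_nat[of R _ degree] by blast
  have p_min: "is_min_poly x p"
    using p leading_coeff_0_iff[of p] bit_not_zero_iff[of "lead_coeff p"]
    unfolding is_min_poly_def R_def by blast
  have "q = p" if q: "is_min_poly x q" for q
  proof (rule ccontr)
    assume "q \<noteq> p"
    have deg: "degree q = degree p"
      using p_min q unfolding is_min_poly_def
      by (metis leading_coeff_0_iff order_antisym zero_neq_one)
    have "q + p \<noteq> 0"
    proof
      assume "q + p = 0"
      then have "q = - p" by (simp add: eq_neg_iff_add_eq_0)
      also have "- p = p" by (rule poly_eqI) simp
      finally show False using \<open>q \<noteq> p\<close> by simp
    qed
    moreover have "poly (map_poly of_bit (q + p)) x = 0"
      unfolding poly_of_bit_add[OF char] using p_min q by (simp add: is_min_poly_def)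
    ultimately have le: "degree p \<le> degree (q + p)"
      using p_min by (simp add: is_min_poly_def)
    have "degree (q + p) \<le> degree p"
      using deg by (simp add: degree_add_le)
    with le have "degree (q + p) = degree p" by simp
    then have "lead_coeff (q + p) = lead_coeff q + lead_coeff p"
      using deg by simp
    also have "\<dots> = 0" using p_min q by (simp add: is_min_poly_def)
    finally show False using \<open>q + p \<noteq> 0\<close> by (simp only: leading_coeff_0_iff)
  qed
  with p_min show ?thesis
    unfolding min_poly_def by (metis theI)
qed

definition unit_group_generator :: "'a::field \<Rightarrow> bool" where
  "unit_group_generator \<alpha> \<longleftrightarrow> range (\<lambda>k::nat. \<alpha> ^ k) = UNIV - {0}"

text \<open>
  A word \<open>(c\<^sub>0, \<dots>, c\<^sub>n\<^sub>-\<^sub>1)\<close> of length \<open>n\<close> is identified with the polynomial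
  \<open>c\<^sub>0 + c\<^sub>1 x + \<dots> + c\<^sub>n\<^sub>-\<^sub>1 x\<^sup>n\<^sup>-\<^sup>1\<close>, and a residue class modulo \<open>x\<^sup>n - 1\<close> with its remainder.
  Hence \<open>cyclic_code n g\<close> is the ideal generated by \<open>g\<close> in the quotient ring.
\<close>

definition words :: "nat \<Rightarrow> bit poly set" where
  "words n = {v. \<forall>i\<ge>n. coeff v i = 0}"

definition cyclic_code :: "nat \<Rightarrow> bit poly \<Rightarrow> bit poly set" where
  "cyclic_code n g = range (\<lambda>f. (f * g) mod (monom 1 n - 1))"

definition inner_prod :: "nat \<Rightarrow> bit poly \<Rightarrow> bit poly \<Rightarrow> bit" where
  "inner_prod n u v = (\<Sum>i<n. coeff u i * coeff v i)"

definition dual_code :: "nat \<Rightarrow> bit poly set \<Rightarrow> bit poly set" where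
  "dual_code n C = {v \<in> words n. \<forall>c\<in>C. inner_prod n c v = 0}"

definition BCH_code :: "'a::field \<Rightarrow> nat \<Rightarrow> nat \<Rightarrow> nat \<Rightarrow> bit poly set" where
  "BCH_code \<alpha> n \<delta> b =
     cyclic_code n (Lcm ((\<lambda>j. min_poly (\<alpha> ^ j)) ` {b..b + \<delta> - 2}))"

definition dually_BCH :: "'a::field \<Rightarrow> nat \<Rightarrow> bit poly set \<Rightarrow> bool" where
  "dually_BCH \<alpha> n C \<longleftrightarrow>
     (\<exists>b' \<delta>'. 1 \<le> b' \<and> 2 \<le> \<delta>' \<and> \<delta>' \<le> n \<and> dual_code n C = BCH_code \<alpha> n \<delta>' b')"

end

theory Submission
  imports Defs "HOL-Number_Theory.Cong"
begin

text \<open>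
  A BCH code consists of the words vanishing at certain powers of \<open>\<alpha>\<close>, and its dual consists of
  the words vanishing at the inverses of the remaining units: one inclusion is Parseval's identity,
  the other pairs words of the form \<open>(trace (\<beta> x\<^sup>i))\<^sub>i\<close>, which span a space with a single cyclotomic
  coset of nonzeros. So the dual is a BCH code iff the negated complement of the cosets of
  \<open>2, \<dots>, \<delta>\<close> is the union of the cosets of an interval. That set contains \<open>0\<close> but not
  \<open>-1\<close>, which forces the interval to be \<open>{0..c}\<close> modulo \<open>n\<close>. If \<open>\<delta>\<close> is at least the second largest
  coset leader \<open>2 ^ (m - 1) - 2 ^ ((m - 1) div 2) - 1\<close>, or \<open>\<delta> = 2\<close>, such a \<open>c\<close> exists. Otherwise
  explicit residues show first \<open>c \<ge> 8\<close>, then \<open>\<delta> < 2 ^ (m - 3) - 1\<close>, then \<open>c \<ge> 2 ^ (m - 2)\<close>,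
  and this contradicts \<open>\<delta> \<ge> 3\<close>.
\<close>

section \<open>Cyclotomic cosets\<close>

text \<open>For \<open>\<alpha>\<close> of order \<open>n\<close> this says that
  \<open>\<alpha> ^ a\<close> and \<open>\<alpha> ^ b\<close> are conjugate. The exponent
  \<open>i\<close> is unbounded, which makes transitivity immediate.\<close>

definition cyclotomic :: "nat \<Rightarrow> nat \<Rightarrow> nat \<Rightarrow> bool" where
  "cyclotomic n a b \<longleftrightarrow> (\<exists>i. [b = a * 2 ^ i] (mod n))"

lemma two_power_cong_1: "[2 ^ m = 1] (mod (2 ^ m - 1 :: nat))"
proof -
  have "[(2 ^ m - 1) + 1 = 0 + 1] (mod (2 ^ m - 1 :: nat))"
    by (intro cong_add) (simp_all add: cong_0_iff)
  then show ?thesis by simp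
qed

lemma two_power_cong_mod: "[2 ^ i = 2 ^ (i mod m)] (mod (2 ^ m - 1 :: nat))"
proof -
  have "(2::nat) ^ i = (2 ^ m) ^ (i div m) * 2 ^ (i mod m)"
    by (metis div_mult_mod_eq mult.commute power_add power_mult)
  moreover have "[(2 ^ m) ^ (i div m) * 2 ^ (i mod m) = 1 ^ (i div m) * 2 ^ (i mod m)] (mod (2 ^ m - 1 :: nat))"
    by (intro cong_mult cong_pow two_power_cong_1) simp
  ultimately show ?thesis by simp
qed

lemma cyclotomic_refl: "cyclotomic n a a"
  unfolding cyclotomic_def by (rule exI[of _ 0]) simp

lemma cyclotomic_mult_power: "cyclotomic n a (a * 2 ^ i)"
  unfolding cyclotomic_def by (rule exI[of _ i]) simp

lemma cyclotomic_trans: "cyclotomic n a b \<Longrightarrow> cyclotomic n b c \<Longrightarrow> cyclotomic n a c"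
proof -
  assume "cyclotomic n a b" "cyclotomic n b c"
  then obtain i j where "[b = a * 2 ^ i] (mod n)" "[c = b * 2 ^ j] (mod n)"
    by (auto simp: cyclotomic_def)
  then have "[c = a * 2 ^ i * 2 ^ j] (mod n)"
    by (meson cong_mult cong_refl cong_trans)
  then show ?thesis
    unfolding cyclotomic_def by (metis mult.assoc power_add)
qed

lemma cyclotomic_cong:
  "[a = a'] (mod n) \<Longrightarrow> [b = b'] (mod n) \<Longrightarrow> cyclotomic n a b \<longleftrightarrow> cyclotomic n a' b'"
  unfolding cyclotomic_def
  by (meson cong_scalar_right cong_sym cong_trans)

lemma cyclotomic_0: "cyclotomic n 0 a \<longleftrightarrow> n dvd a"
  by (simp add: cyclotomic_def cong_0_iff)

text \<open>Cosets are compatible with negation. Negatives are described by congruences because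
  subtraction on \<open>nat\<close> is truncated.\<close>

lemma cyclotomic_uminus:
  assumes "cyclotomic n a b" "[a + a' = 0] (mod n)" "[b + b' = 0] (mod n)"
  shows "cyclotomic n a' b'"
proof -
  obtain i where "[b = a * 2 ^ i] (mod n)" using assms(1) by (auto simp: cyclotomic_def)
  then have "[b + a' * 2 ^ i = a * 2 ^ i + a' * 2 ^ i] (mod n)" by (rule cong_add) simp
  also have "a * 2 ^ i + a' * 2 ^ i = (a + a') * 2 ^ i" by (simp add: distrib_right)
  also have "[(a + a') * 2 ^ i = 0 * 2 ^ i] (mod n)" using assms(2) by (rule cong_scalar_right)
  also have "0 * 2 ^ i = (0::nat)" by simp
  also have "[0 = b + b'] (mod n)" using assms(3) by (rule cong_sym)
  finally have "[b' = a' * 2 ^ i] (mod n)" by (metis cong_add_lcancel_nat cong_sym)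
  then show ?thesis by (auto simp: cyclotomic_def)
qed

text \<open>
  The exponents of the common zeros of the dual code are the negatives of the exponents of the
  nonzeros of the code, whence \<open>k + k' = 0\<close>.
\<close>

definition dual_intervals :: "nat \<Rightarrow> nat \<Rightarrow> nat \<Rightarrow> nat \<Rightarrow> bool" where
  "dual_intervals n \<delta> b' \<delta>' \<longleftrightarrow> (\<forall>k k'. [k + k' = 0] (mod n) \<longrightarrow>
     (\<exists>j\<in>{b'..b' + \<delta>' - 2}. cyclotomic n j k) \<noteq> (\<exists>j\<in>{2..\<delta>}. cyclotomic n j k'))"

context
  fixes m n :: nat
  assumes n_eq: "n = 2 ^ m - 1" and m_ge: "m \<ge> 6"
begin

text \<open>Doubling modulo \<open>n\<close> rotates the \<open>m\<close> binary digits of a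
  residue, so fewer than \<open>m\<close> doublings suffice.\<close>

lemma cyclotomic_iff: "cyclotomic n a b \<longleftrightarrow> (\<exists>i<m. [b = a * 2 ^ i] (mod n))"
proof
  assume "cyclotomic n a b"
  then obtain i where "[b = a * 2 ^ i] (mod n)" by (auto simp: cyclotomic_def)
  moreover have "[a * 2 ^ i = a * 2 ^ (i mod m)] (mod n)"
    unfolding n_eq by (intro cong_mult two_power_cong_mod) simp
  ultimately show "\<exists>i<m. [b = a * 2 ^ i] (mod n)"
    using m_ge by (intro exI[of _ "i mod m"]) (auto intro: cong_trans)
qed (auto simp: cyclotomic_def)

text \<open>Modulo \<open>n\<close>, the power \<open>2 ^ (m - i)\<close> is inverse to
  \<open>2 ^ i\<close>.\<close>

lemma cyclotomic_sym: "cyclotomic n a b \<Longrightarrow> cyclotomic n b a"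
proof -
  assume "cyclotomic n a b"
  then obtain i where i: "i < m" "[b = a * 2 ^ i] (mod n)" by (auto simp: cyclotomic_iff)
  have "[b * 2 ^ (m - i) = a * 2 ^ i * 2 ^ (m - i)] (mod n)"
    using i(2) by (rule cong_scalar_right)
  also have "a * 2 ^ i * 2 ^ (m - i) = a * 2 ^ m"
    using i(1) by (simp add: mult.assoc flip: power_add)
  also have "[a * 2 ^ m = a * 1] (mod n)"
    unfolding n_eq by (intro cong_mult two_power_cong_1) simp
  finally show ?thesis
    unfolding cyclotomic_def by (intro exI[of _ "m - i"]) (simp add: cong_sym)
qed

section \<open>Sizes of the members of a coset\<close>

lemma n_plus_1_eqs:
  shows "n + 1 = 2 * 2 ^ (m - 1)" "n + 1 = 4 * 2 ^ (m - 2)" "n + 1 = 8 * 2 ^ (m - 3)"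
    and "8 \<le> (2::nat) ^ (m - 3)"
proof -
  have "(2::nat) ^ 3 \<le> 2 ^ (m - 3)" using m_ge by (intro power_increasing) auto
  then show "8 \<le> (2::nat) ^ (m - 3)" by simp
  have "(2::nat) ^ m = 2 ^ j * 2 ^ (m - j)" if "j \<le> m" for j
    using that by (simp flip: power_add)
  from this[of 1] this[of 2] this[of 3]
  have "(2::nat) ^ m = 2 * 2 ^ (m - 1)" "(2::nat) ^ m = 4 * 2 ^ (m - 2)" "(2::nat) ^ m = 8 * 2 ^ (m - 3)"
    using m_ge by simp_all
  then show "n + 1 = 2 * 2 ^ (m - 1)" "n + 1 = 4 * 2 ^ (m - 2)" "n + 1 = 8 * 2 ^ (m - 3)"
    by (simp_all add: n_eq)
qed

lemma cyclotomic_2_1: "cyclotomic n 2 1"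
  by (rule cyclotomic_sym) (auto simp: cyclotomic_def intro!: exI[of _ 1])

lemma cyclotomic_to_0: "cyclotomic n a 0 \<longleftrightarrow> n dvd a"
  using cyclotomic_sym cyclotomic_0 by blast

text \<open>The residue has two binary ones. With \<open>h = (m - 1) div 2\<close>, the cyclic gaps
  between them are \<open>m - 1 - h\<close> and \<open>h + 1\<close>, both at least 3, so every
  rotation has a one at position 3 or higher. The gaps are as equal as possible up to order, and no
  rotation exceeds the given one.\<close>

lemma cyclotomic_top_pair:
  assumes "cyclotomic n (2 ^ (m - 1) + 2 ^ ((m - 1) div 2)) z"
  shows "z mod n \<le> 2 ^ (m - 1) + 2 ^ ((m - 1) div 2) \<and> 8 \<le> z mod n"
proof -
  define h where "h = (m - 1) div 2"
  define y :: nat where "y = 2 ^ (m - 1) + 2 ^ h"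
  have h: "2 \<le> h" "2 * h \<le> m - 1" "m \<le> 2 * h + 2"
    using m_ge by (auto simp: h_def)
  have le2: "(2::nat) ^ h \<le> 2 ^ (m - 2)" using h m_ge by (intro power_increasing) auto
  note ne = n_plus_1_eqs
  have e12: "(2::nat) ^ (m - 1) = 2 * 2 ^ (m - 2)" "(2::nat) ^ (m - 2) = 2 * 2 ^ (m - 3)"
    using ne by linarith+
  have y: "y < n" "8 \<le> y" using le2 ne e12 by (auto simp: y_def)
  obtain i where i: "i < m" "[z = y * 2 ^ i] (mod n)"
    using assms by (auto simp: cyclotomic_iff y_def h_def)
  show ?thesis
  proof (cases "i = 0")
    case True
    with i y have "z mod n = y" by (simp add: cong_def)
    with y show ?thesis by (simp add: y_def h_def)
  next
    case False
    define q where "q = (h + i) mod m"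
    \<comment> \<open>The leading one wraps around to position \<open>i - 1\<close>; the other one
      lands at position \<open>q\<close>.\<close>
    have "y * 2 ^ i = 2 ^ m * 2 ^ (i - 1) + 2 ^ (h + i)"
    proof -
      have "m - 1 + i = m + (i - 1)" using False m_ge by simp
      then show ?thesis by (simp add: y_def distrib_right flip: power_add)
    qed
    also have "[2 ^ m * 2 ^ (i - 1) + 2 ^ (h + i) = 1 * 2 ^ (i - 1) + 2 ^ q] (mod n)"
      unfolding n_eq q_def by (intro cong_add cong_mult two_power_cong_1 two_power_cong_mod) simp
    finally have z: "[z = 2 ^ (i - 1) + 2 ^ q] (mod n)"
      using i(2) by (auto intro: cong_trans)
    have bound: "2 ^ (i - 1) + 2 ^ q \<le> y \<and> 8 \<le> (2 ^ (i - 1) + 2 ^ q :: nat)"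
    proof (cases "h + i < m")
      case hi: True
      then have q: "q = h + i" by (simp add: q_def)
      have "(8::nat) \<le> 2 ^ q" using power_increasing[of 3 q "2::nat"] h False q by simp
      moreover have "(2::nat) ^ q \<le> 2 ^ (m - 1)" using q hi by (intro power_increasing) auto
      moreover have "(2::nat) ^ (i - 1) \<le> 2 ^ h" using hi h by (intro power_increasing) auto
      ultimately show ?thesis unfolding y_def by (intro conjI) linarith+
    next
      \<comment> \<open>Both ones have wrapped, so \<open>i - 1\<close> is now the higher
        position.\<close>
      case hi: False
      then have q: "q = h + i - m" using i(1) h by (auto simp: q_def le_mod_geq)
      have "(8::nat) \<le> 2 ^ (i - 1)" using power_increasing[of 3 "i - 1" "2::nat"] h hi m_ge by simp
      moreover have "(2::nat) ^ (i - 1) \<le> 2 ^ (m - 1)" using i by (intro power_increasing) auto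
      moreover have "(2::nat) ^ q \<le> 2 ^ h" using q i(1) by (intro power_increasing) auto
      ultimately show ?thesis unfolding y_def by (intro conjI) linarith+
    qed
    with y have "(2 ^ (i - 1) + 2 ^ q) mod n = 2 ^ (i - 1) + 2 ^ q" by simp
    with z bound show ?thesis by (simp add: cong_def y_def h_def)
  qed
qed

text \<open>Three times \<open>n div 3\<close> is 0 or -1 modulo \<open>n\<close>, so the reduced
  member \<open>w\<close> of the coset satisfies \<open>3 * w + s = k * n\<close> with
  \<open>s\<close> equal to 0 or to a power \<open>2 ^ i\<close>. Since \<open>k\<close> is 1 or 2,
  both bounds follow.\<close>

lemma cyclotomic_third:
  assumes "cyclotomic n (n div 3) z"
  shows "2 ^ (m - 3) \<le> z mod n \<and> 2 ^ (m - 2) \<le> n - z mod n"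
proof -
  note ne = n_plus_1_eqs
  define w where "w = z mod n"
  have w: "w < n" using ne by (simp add: w_def)
  obtain i where i: "i < m" "[z = n div 3 * 2 ^ i] (mod n)"
    using assms by (auto simp: cyclotomic_iff)
  have pi: "(2::nat) ^ i \<le> 2 ^ (m - 1)" using i by (intro power_increasing) auto
  have wz: "[w = n div 3 * 2 ^ i] (mod n)" using i(2) by (simp add: w_def cong_def)
  have not3: "\<not> 3 dvd (2::nat) ^ k" for k
    using prime_dvd_power[of "3::nat" 2 k] by (auto dest: dvd_imp_le)
  have "\<not> 3 dvd n + 1" using not3[of m] ne(1) by (simp add: n_eq)
  then have "n mod 3 \<noteq> 2" by presburger
  then have "n mod 3 = 0 \<or> n mod 3 = 1" by linarith
  then have "\<exists>k s. 3 * w + s = k * n \<and> s \<le> 2 ^ (m - 1) \<and> 0 < k \<and> k < 3"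
  proof
    assume "n mod 3 = 0"
    then have n3: "3 * (n div 3) = n" by (metis mult_div_mod_eq add.right_neutral)
    have "[3 * w = 3 * (n div 3 * 2 ^ i)] (mod n)" using wz by (rule cong_scalar_left)
    also have "3 * (n div 3 * 2 ^ i) = n * 2 ^ i" using n3 by (metis mult.assoc)
    also have "[n * 2 ^ i = 0] (mod n)" by (simp add: cong_0_iff)
    finally obtain k where k: "3 * w = n * k" by (auto simp: cong_0_iff elim: dvdE)
    have "w \<noteq> 0"
    proof
      assume "w = 0"
      then have "n dvd n div 3 * 2 ^ i" using wz by (metis cong_0_iff cong_sym)
      \<comment> \<open>As \<open>n\<close> is odd, the power of 2 cancels.\<close>
      moreover have "coprime n (2 ^ i)" using ne(1) by (simp add: coprime_right_2_iff_odd) presburger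
      ultimately have "n dvd n div 3" by (simp add: coprime_dvd_mult_left_iff)
      then show False using ne n3 by (auto dest: dvd_imp_le)
    qed
    then have "k > 0" using k by (cases k) auto
    moreover have "k < 3" proof -
      have "n * k < n * 3" using k w by linarith
      then show ?thesis by simp
    qed
    ultimately show ?thesis using k by (intro exI[of _ k] exI[of _ 0]) (simp add: mult.commute)
  next
    assume "n mod 3 = 1"
    then have n3: "3 * (n div 3) + 1 = n" by (metis mult_div_mod_eq)
    have "[3 * w + 2 ^ i = 3 * (n div 3 * 2 ^ i) + 2 ^ i] (mod n)" using wz by (intro cong_add cong_scalar_left) auto
    also have "3 * (n div 3 * 2 ^ i) + 2 ^ i = n * 2 ^ i" using n3 by (metis mult.assoc distrib_right mult_1)
    also have "[n * 2 ^ i = 0] (mod n)" by (simp add: cong_0_iff)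
    finally obtain k where k: "3 * w + 2 ^ i = n * k" by (auto simp: cong_0_iff elim: dvdE)
    have "k > 0" using k by (cases k) auto
    moreover have "k < 4"
    proof -
      have "n * k < n * 4" using k w pi ne(1) by linarith
      then show ?thesis by simp
    qed
    moreover have "k \<noteq> 3"
    proof
      assume "k = 3"
      then have "2 ^ i = 3 * (n - w)" using k w by (simp add: diff_mult_distrib2)
      then show False using not3[of i] by simp
    qed
    ultimately show ?thesis using k pi
      by (intro exI[of _ k] exI[of _ "2 ^ i"]) (simp add: mult.commute)
  qed
  then obtain k s where k: "3 * w + s = k * n" "s \<le> 2 ^ (m - 1)" "0 < k" "k < 3"
    by blast
  then have "k = 1 \<or> k = 2" by linarith
  with k have "n \<le> 3 * w + 2 ^ (m - 1)" "3 * w \<le> 2 * n" by auto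
  then show ?thesis unfolding w_def[symmetric] using ne by linarith
qed

text \<open>A residue in neither excluded coset has at least two binary ones, and a suitable
  rotation puts one at the top and another close below it. After negation this bounds the leader of
  every coset except those of 0 and -1.\<close>

lemma ex_cyclotomic_ge:
  assumes "\<not> n dvd k" "\<not> cyclotomic n 1 k"
  shows "\<exists>z. cyclotomic n k z \<and> 2 ^ (m - 1) + 2 ^ ((m - 1) div 2) \<le> z \<and> z < n"
proof -
  note ne = n_plus_1_eqs
  define h where "h = (m - 1) div 2"
  have h: "2 \<le> h" "2 * h \<le> m - 1" "m \<le> 2 * h + 2"
    using m_ge by (auto simp: h_def)
  have log: "\<exists>e. 2 ^ e \<le> x \<and> x < 2 ^ (e + 1)" if "x > 0" for x :: nat
    using ex_power_ivl1[of 2 x] that by auto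
  define x where "x = k mod n"
  have x: "0 < x" "x < n" using assms ne by (auto simp: x_def dvd_eq_mod_eq_0)
  have kx: "cyclotomic n k x" by (auto simp: x_def cyclotomic_def cong_def intro!: exI[of _ 0])
  obtain e where e: "2 ^ e \<le> x" "x < 2 ^ (e + 1)" using log x by blast
  have em: "e < m"
  proof (rule ccontr)
    assume "\<not> e < m"
    then have "(2::nat) ^ m \<le> 2 ^ e" by (intro power_increasing) auto
    then show False using e x n_eq by linarith
  qed
  \<comment> \<open>\<open>M\<close> is the rotation whose leading one sits at the top position
    \<open>m - 1\<close>.\<close>
  define M where "M = x * 2 ^ (m - 1 - e)"
  have kM: "cyclotomic n k M"
    using kx unfolding M_def by (rule cyclotomic_trans[OF _ cyclotomic_mult_power])
  have M1: "2 ^ (m - 1) \<le> M"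
  proof -
    have "2 ^ e * 2 ^ (m - 1 - e) \<le> M" unfolding M_def using e by simp
    then show ?thesis using em by (simp flip: power_add)
  qed
  have M2: "M \<le> n"
  proof -
    have "M < 2 ^ (e + 1) * 2 ^ (m - 1 - e)" unfolding M_def using e by simp
    also have "\<dots> = 2 ^ m" using em by (simp add: power_add[symmetric] del: power_Suc)
    finally show ?thesis using n_eq by simp
  qed
  have "\<not> n dvd M"
    using assms(1) kM cyclotomic_0 cyclotomic_trans cyclotomic_to_0 by blast
  then have M2: "M < n" using M2 by (cases "M = n") auto
  have "\<not> cyclotomic n 1 M" using assms(2) kM cyclotomic_sym cyclotomic_trans by blast
  moreover have "cyclotomic n 1 (2 ^ (m - 1))" using cyclotomic_mult_power[of n 1 "m - 1"] by simp
  ultimately have "M \<noteq> 2 ^ (m - 1)" by auto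
  (* M has leading digit 2 ^ (m - 1). If the next one 2 ^ f is too far below, then the cyclic shift
     that moves 2 ^ f to the top brings the leading digit to 2 ^ (m - 2 - f). *)
  show ?thesis
  proof (cases "2 ^ (m - 1) + 2 ^ h \<le> M")
    case True
    with kM M2 show ?thesis by (auto simp: h_def)
  next
    case False
    define r where "r = M - 2 ^ (m - 1)"
    have Mr: "M = 2 ^ (m - 1) + r" using M1 by (simp add: r_def)
    have r: "0 < r" "r < 2 ^ h" using False M1 \<open>M \<noteq> _\<close> by (auto simp: r_def)
    obtain f where f: "2 ^ f \<le> r" "r < 2 ^ (f + 1)" using log r by blast
    have fh: "f < h"
    proof (rule ccontr)
      assume "\<not> f < h"
      then have "(2::nat) ^ h \<le> 2 ^ f" by (intro power_increasing) auto
      then show False using f r by linarith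
    qed
    define z where "z = r * 2 ^ (m - 1 - f) + 2 ^ (m - 2 - f)"
    have "M * 2 ^ (m - 1 - f) = r * 2 ^ (m - 1 - f) + 2 ^ m * 2 ^ (m - 2 - f)"
    proof -
      have "m - 1 + (m - 1 - f) = m + (m - 2 - f)" using fh h by simp
      then show ?thesis by (simp add: Mr distrib_right flip: power_add)
    qed
    also have "[\<dots> = r * 2 ^ (m - 1 - f) + 1 * 2 ^ (m - 2 - f)] (mod n)"
      unfolding n_eq by (intro cong_add cong_mult two_power_cong_1) auto
    finally have "cyclotomic n M z" by (auto simp: cyclotomic_def z_def intro: cong_sym)
    moreover have "2 ^ (m - 1) + 2 ^ h \<le> z"
    proof -
      have "2 ^ f * 2 ^ (m - 1 - f) \<le> r * 2 ^ (m - 1 - f)" using f by simp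
      moreover have "(2::nat) ^ f * 2 ^ (m - 1 - f) = 2 ^ (m - 1)" using fh h by (simp flip: power_add)
      moreover have "(2::nat) ^ h \<le> 2 ^ (m - 2 - f)" using fh h by (intro power_increasing) auto
      ultimately show ?thesis unfolding z_def by linarith
    qed
    moreover have "z < n"
    proof -
      \<comment> \<open>The shifted \<open>r\<close> leaves the lowest \<open>m - 1 - f\<close>
        positions empty, so the wrapped digit fits there without a carry.\<close>
      have "(r + 1) * 2 ^ (m - 1 - f) \<le> 2 ^ (f + 1) * 2 ^ (m - 1 - f)" using f by (intro mult_right_mono) auto
      also have "(2::nat) ^ (f + 1) * 2 ^ (m - 1 - f) = 2 ^ m" using fh h by (simp add: power_add[symmetric] del: power_Suc)
      finally have "r * 2 ^ (m - 1 - f) + 2 ^ (m - 1 - f) \<le> 2 ^ m" by simp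
      moreover have "(2::nat) ^ (m - 1 - f) = 2 * 2 ^ (m - 2 - f)"
      proof -
        have "m - 1 - f = Suc (m - 2 - f)" using fh h by simp
        then show ?thesis by simp
      qed
      moreover have "(2::nat) ^ 1 \<le> 2 ^ (m - 2 - f)" using fh h by (intro power_increasing) auto
      ultimately show ?thesis by (simp add: z_def n_eq)
    qed
    ultimately show ?thesis using cyclotomic_trans[OF kM] unfolding h_def by blast
  qed
qed

section \<open>Intervals that satisfy the duality condition\<close>

lemma two_power_ineqs:
  "(2::nat) ^ ((m - 1) div 2) \<le> 2 ^ (m - 2)" "(4::nat) \<le> 2 ^ ((m - 1) div 2)"
proof -
  show "(2::nat) ^ ((m - 1) div 2) \<le> 2 ^ (m - 2)" using m_ge by (intro power_increasing) auto
  have "(2::nat) ^ 2 \<le> 2 ^ ((m - 1) div 2)" using m_ge by (intro power_increasing) auto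
  then show "(4::nat) \<le> 2 ^ ((m - 1) div 2)" by simp
qed

text \<open>The condition is tested at a few residues. Once the start of the interval is known, each
  further test lengthens the interval or lowers the bound on \<open>\<delta>\<close>, until the
  coset of 3 gives a contradiction.\<close>

lemma dual_intervalsD:
  assumes d: "dual_intervals n \<delta> b' \<delta>'" and b': "1 \<le> b'" and \<delta>': "2 \<le> \<delta>'" "\<delta>' \<le> n"
    and \<delta>: "3 \<le> \<delta>" "\<delta> \<le> n"
  shows "2 ^ (m - 1) - 2 ^ ((m - 1) div 2) - 1 \<le> \<delta> \<and> \<delta> \<le> n - 1"
proof -
  note ne = n_plus_1_eqs and tp = two_power_ineqs
  have D: "(\<exists>j\<in>{b'..b' + \<delta>' - 2}. cyclotomic n j k) \<longleftrightarrow> \<not> (\<exists>j\<in>{2..\<delta>}. cyclotomic n j k')"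
    if "n dvd k + k'" for k k'
    using d that unfolding dual_intervals_def by (metis cong_0_iff)
  \<comment> \<open>For \<open>\<delta> = n\<close> the set \<open>{2..\<delta>}\<close> meets every
    coset: \<open>n\<close> represents 0 and 2 represents 1. Then nothing is left for the other
    interval, which contains at least \<open>b'\<close>.\<close>
  have "\<delta> \<noteq> n"
  proof
    assume "\<delta> = n"
    have all: "\<exists>j\<in>{2..\<delta>}. cyclotomic n j k" for k
    proof (cases "k mod n = 0 \<or> k mod n = 1")
      case True
      have "cyclotomic n n k" if "k mod n = 0"
        using that by (auto simp: cyclotomic_def cong_def intro!: exI[of _ 0])
      moreover have "cyclotomic n 2 k" if "k mod n = 1"
        using that cyclotomic_cong[of 2 2 n 1 k] cyclotomic_2_1 ne by (auto simp: cong_def)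
      moreover have "n \<in> {2..\<delta>}" "2 \<in> {2..\<delta>}" using \<delta> \<open>\<delta> = n\<close> by simp_all
      ultimately show ?thesis using True by metis
    next
      case False
      then have "k mod n \<in> {2..\<delta>}" using \<open>\<delta> = n\<close> ne by (auto intro: less_imp_le)
      moreover have "cyclotomic n (k mod n) k" by (auto simp: cyclotomic_def cong_def intro!: exI[of _ 0])
      ultimately show ?thesis by blast
    qed
    have "b' + (n - 1) * b' = n * b'" using ne(1) by (cases n) auto
    then have "n dvd b' + (n - 1) * b'" by simp
    from D[OF this] all have "\<not> (\<exists>j\<in>{b'..b' + \<delta>' - 2}. cyclotomic n j b')" by blast
    moreover have "b' \<in> {b'..b' + \<delta>' - 2}" using \<delta>' by auto
    ultimately show False using cyclotomic_refl by blast
  qed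
  then have \<delta>n: "\<delta> < n" using \<delta> by simp
  moreover have "2 ^ (m - 1) - 2 ^ ((m - 1) div 2) - 1 \<le> \<delta>"
  proof (rule ccontr)
    assume lt: "\<not> ?thesis"
    have "\<not> (\<exists>j\<in>{2..\<delta>}. cyclotomic n j 0)"
      using \<delta>n by (auto simp: cyclotomic_to_0 dest: dvd_imp_le)
    with D[of 0 0] obtain j0 where j0: "j0 \<in> {b'..b' + \<delta>' - 2}" "n dvd j0"
      by (auto simp: cyclotomic_to_0)
    \<comment> \<open>A multiple of \<open>n\<close> further right would have a predecessor
      congruent to -1 in the interval, although 1 is covered by 2 on the other side.\<close>
    have "j0 = b'"
    proof (rule ccontr)
      assume "j0 \<noteq> b'"
      then have "j0 - 1 \<in> {b'..b' + \<delta>' - 2}" "n dvd (j0 - 1) + 1" using j0 by auto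
      with D[of "j0 - 1" 1] have "\<not> (\<exists>j\<in>{2..\<delta>}. cyclotomic n j 1)" using cyclotomic_refl by blast
      then show False using cyclotomic_2_1 \<delta> by auto
    qed
    with j0 have nb: "n dvd b'" by simp
    \<comment> \<open>Modulo \<open>n\<close> the interval is now \<open>{0..c}\<close>.\<close>
    define c where "c = \<delta>' - 2"
    have c: "c < n" using \<delta>' ne by (auto simp: c_def)
    have I: "(\<exists>j\<in>{b'..b' + \<delta>' - 2}. cyclotomic n j k) \<longleftrightarrow> (\<exists>t\<le>c. cyclotomic n t k)" for k
    proof -
      have "b' + \<delta>' - 2 = b' + c" using \<delta>' by (simp add: c_def)
      then have eq: "{b'..b' + \<delta>' - 2} = (+) b' ` {0..c}" by simp
      have cc: "cyclotomic n (b' + t) k \<longleftrightarrow> cyclotomic n t k" for t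
      proof (rule cyclotomic_cong)
        have "[b' + t = 0 + t] (mod n)" using nb by (intro cong_add) (auto simp: cong_0_iff)
        then show "[b' + t = t] (mod n)" by simp
      qed simp
      show ?thesis unfolding eq by (simp only: bex_simps cc) auto
    qed
    have E: "(\<exists>t\<le>c. cyclotomic n t k) \<longleftrightarrow> \<not> (\<exists>j\<in>{2..\<delta>}. cyclotomic n j k')"
      if "n dvd k + k'" for k k'
      using D[OF that] I by simp
    define y where "y = (2::nat) ^ (m - 1) + 2 ^ ((m - 1) div 2)"
    have yn: "y < n" using ne tp by (simp add: y_def)
    (* n - y is the second largest coset leader, which exceeds \<delta>. *)
    have "c \<ge> 8"
    proof -
      have "\<not> cyclotomic n j (n - y)" if "j \<in> {2..\<delta>}" for j
      proof
        assume "cyclotomic n j (n - y)"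
        then have "cyclotomic n (n - y) j" by (rule cyclotomic_sym)
        then have "cyclotomic n y (n - j)"
          by (rule cyclotomic_uminus) (use that \<delta>n yn in \<open>auto simp: cong_0_iff\<close>)
        then have "(n - j) mod n \<le> y" using cyclotomic_top_pair by (simp add: y_def)
        moreover have "(n - j) mod n = n - j" using that \<delta>n by auto
        ultimately have "n \<le> y + j" by linarith
        moreover have "j < 2 ^ (m - 1) - 2 ^ ((m - 1) div 2) - 1" using that lt by simp
        ultimately show False using ne(1) unfolding y_def by linarith
      qed
      \<comment> \<open>So \<open>y\<close> belongs to the coset of some \<open>t \<le> c\<close>,
        and every member of that coset is at least 8 modulo \<open>n\<close>.\<close>
      then obtain t where t: "t \<le> c" "cyclotomic n t y"
        using E[of y "n - y"] yn by auto
      then have "8 \<le> t mod n" using cyclotomic_sym cyclotomic_top_pair by (simp add: y_def)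
      then show ?thesis using t c by simp
    qed
    \<comment> \<open>The residue 7 has three ones, so its negative is a rotation of
      \<open>m - 3\<close> ones, that is, of \<open>2 ^ (m - 3) - 1\<close>. This number must
      therefore exceed \<open>\<delta>\<close>.\<close>
    then have "\<exists>t\<le>c. cyclotomic n t 7" using cyclotomic_refl[of n 7] by (intro exI[of _ 7]) auto
    then have no7: "\<not> (\<exists>j\<in>{2..\<delta>}. cyclotomic n j (n - 7))"
      using E[of 7 "n - 7"] ne by auto
    have "cyclotomic n (2 ^ (m - 3) - 1) (n - 7)"
    proof -
      have "n - 7 = (2 ^ (m - 3) - 1) * 2 ^ 3" using ne(3) by (simp add: diff_mult_distrib)
      then show ?thesis unfolding cyclotomic_def by (metis cong_refl)
    qed
    then have \<delta>small: "\<delta> < 2 ^ (m - 3) - 1" using no7 ne(4) by force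
    (* The binary digits of n div 3 alternate, so all shifts of it and of its negative are large. *)
    have "\<not> cyclotomic n j (n div 3)" if "j \<in> {2..\<delta>}" for j
    proof
      assume "cyclotomic n j (n div 3)"
      then have "2 ^ (m - 3) \<le> j mod n" using cyclotomic_third cyclotomic_sym by blast
      moreover have "j mod n = j" using that \<delta>n by simp
      ultimately show False using that \<delta>small unfolding atLeastAtMost_iff by linarith
    qed
    then obtain t where t: "t \<le> c" "cyclotomic n t (n - n div 3)"
      using E[of "n - n div 3" "n div 3"] by auto
    \<comment> \<open>For \<open>t > 0\<close>, the negative \<open>n - t\<close> lies in the coset
      of \<open>n div 3\<close>, whose members stay \<open>2 ^ (m - 2)\<close> below
      \<open>n\<close>; hence \<open>t\<close> is at least that large.\<close>
    have "2 ^ (m - 2) \<le> c"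
    proof (cases "t = 0")
      case True
      then have "n dvd n - n div 3" using t by (simp add: cyclotomic_0)
      then show ?thesis using ne by (auto dest: dvd_imp_le)
    next
      case False
      from t(2) have "cyclotomic n (n - n div 3) t" by (rule cyclotomic_sym)
      then have "cyclotomic n (n div 3) (n - t)"
        by (rule cyclotomic_uminus) (use t c in \<open>auto simp: cong_0_iff\<close>)
      then have "2 ^ (m - 2) \<le> n - (n - t) mod n" using cyclotomic_third by blast
      then show ?thesis using False t c by simp
    qed
    \<comment> \<open>The negative of \<open>2 ^ (m - 2) - 1\<close> has just two adjacent ones and
      is a rotation of 3, which lies in \<open>{2..\<delta>}\<close>.\<close>
    then have "\<exists>t\<le>c. cyclotomic n t (2 ^ (m - 2) - 1)"
      using cyclotomic_refl[of n "2 ^ (m - 2) - 1"] by (intro exI[of _ "2 ^ (m - 2) - 1"]) auto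
    moreover have "n dvd (2 ^ (m - 2) - 1) + 3 * 2 ^ (m - 2)"
    proof -
      have "(2 ^ (m - 2) - 1) + 3 * 2 ^ (m - 2) = n" using ne by linarith
      then show ?thesis by simp
    qed
    ultimately have "\<not> (\<exists>j\<in>{2..\<delta>}. cyclotomic n j (3 * 2 ^ (m - 2)))" using E by blast
    moreover have "cyclotomic n 3 (3 * 2 ^ (m - 2))" by (rule cyclotomic_mult_power)
    ultimately show False using \<delta> by force
  qed
  ultimately show ?thesis by simp
qed

text \<open>This is \<open>ex_cyclotomic_ge\<close> read through negation: a large \<open>z\<close>
  in the coset of \<open>k\<close> becomes a small \<open>n - z\<close> in that of
  \<open>k'\<close>.\<close>

lemma cyclotomic_trichotomy:
  assumes "[k + k' = 0] (mod n)"
  obtains "n dvd k" | "cyclotomic n 1 k"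
    | j where "1 \<le> j" "j \<le> 2 ^ (m - 1) - 2 ^ ((m - 1) div 2) - 1" "cyclotomic n j k'"
proof (cases "n dvd k \<or> cyclotomic n 1 k")
  case False
  then obtain z where z: "cyclotomic n k z" "2 ^ (m - 1) + 2 ^ ((m - 1) div 2) \<le> z" "z < n"
    using ex_cyclotomic_ge by blast
  from cyclotomic_sym[OF z(1)] have "cyclotomic n (n - z) k'"
    by (rule cyclotomic_uminus) (use z assms in \<open>auto simp: cong_0_iff\<close>)
  moreover have "1 \<le> n - z" "n - z \<le> 2 ^ (m - 1) - 2 ^ ((m - 1) div 2) - 1"
    using z n_plus_1_eqs(1) by linarith+
  ultimately show ?thesis by (intro that(3))
qed (use that in blast)

text \<open>Here \<open>k'\<close> lies in the coset of -1, whose reduced members are the numbers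
  \<open>n - 2 ^ i\<close> with \<open>i < m\<close>. The least of them is
  \<open>2 ^ (m - 1) - 1\<close>.\<close>

lemma not_cyclotomic_small:
  assumes "[k + k' = 0] (mod n)" "cyclotomic n 1 k" "cyclotomic n j k'"
  shows "2 ^ (m - 1) - 1 \<le> j"
proof (rule ccontr)
  assume "\<not> ?thesis"
  then have j: "j + 2 \<le> 2 ^ (m - 1)" by simp
  have jn: "j < n" using j n_plus_1_eqs by simp
  have "cyclotomic n k 1" using assms by (blast intro: cyclotomic_sym)
  have "cyclotomic n k' (n - 1)"
    by (rule cyclotomic_uminus[of n k 1]) (use assms n_plus_1_eqs in \<open>auto simp: cong_0_iff intro: cyclotomic_sym\<close>)
  then have "cyclotomic n (n - 1) j"
    using assms cyclotomic_trans cyclotomic_sym by blast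
  then have "cyclotomic n 1 (n - j)"
    by (rule cyclotomic_uminus) (use jn n_plus_1_eqs in \<open>auto simp: cong_0_iff\<close>)
  then obtain i where i: "i < m" "[n - j = 2 ^ i] (mod n)" by (auto simp: cyclotomic_iff)
  have "[n - j + j = 2 ^ i + j] (mod n)" using i(2) by (rule cong_add) simp
  then have "n dvd 2 ^ i + j" using jn by (auto simp: cong_def dvd_eq_mod_eq_0)
  moreover have "(2::nat) ^ i \<le> 2 ^ (m - 1)" using i by (intro power_increasing) auto
  moreover have "(0::nat) < 2 ^ i" by simp
  ultimately show False using j n_plus_1_eqs(1) dvd_imp_le[of n "2 ^ i + j"] by linarith
qed

text \<open>The code has the coset of 1 as its zeros, so the dual must omit exactly the coset of -1.
  That coset has the largest leader, \<open>2 ^ (m - 1) - 1\<close>, so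
  \<open>{0..2 ^ (m - 1) - 2}\<close> works. The start is \<open>n\<close> instead of 0 because
  \<open>b'\<close> has to be positive.\<close>

lemma dual_intervalsI_2: "dual_intervals n 2 n (2 ^ (m - 1))"
  unfolding dual_intervals_def
proof (intro allI impI)
  note ne = n_plus_1_eqs and tp = two_power_ineqs
  fix k k' assume kk: "[k + k' = 0] (mod n)"
  then have kk': "[k' + k = 0] (mod n)" by (simp add: add.commute)
  define e where "e = 2 ^ (m - 1) - (2::nat)"
  have "n + 2 ^ (m - 1) - 2 = n + e" using ne(1,3,4) unfolding e_def by linarith
  then have eq: "{n..n + 2 ^ (m - 1) - 2} = (+) n ` {0..e}" by simp
  have cc: "cyclotomic n (n + t) k \<longleftrightarrow> cyclotomic n t k" for t
    by (rule cyclotomic_cong) (auto simp: cong_def)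
  have c2: "cyclotomic n 2 k' \<longleftrightarrow> cyclotomic n 1 k'"
    using cyclotomic_2_1 cyclotomic_sym cyclotomic_trans by blast
  have "(\<exists>t\<le>e. cyclotomic n t k) \<longleftrightarrow> \<not> cyclotomic n 1 k'"
  proof
    assume "\<exists>t\<le>e. cyclotomic n t k"
    then obtain t where t: "t \<le> e" "cyclotomic n t k" by blast
    show "\<not> cyclotomic n 1 k'"
      using not_cyclotomic_small[OF kk' _ t(2)] t(1) ne by (auto simp: e_def)
  next
    assume a: "\<not> cyclotomic n 1 k'"
    from kk' show "\<exists>t\<le>e. cyclotomic n t k"
    proof (cases rule: cyclotomic_trichotomy)
      case 1
      then have "n dvd k" using kk by (metis cong_0_iff dvd_add_left_iff)
      then show ?thesis by (intro exI[of _ 0]) (simp add: cyclotomic_0)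
    next
      case 2 with a show ?thesis by simp
    next
      case (3 j)
      moreover have "j \<le> e" using 3(2) tp(2) unfolding e_def by linarith
      ultimately show ?thesis by blast
    qed
  qed
  then show "(\<exists>j\<in>{n..n + 2 ^ (m - 1) - 2}. cyclotomic n j k) \<noteq> (\<exists>j\<in>{2..2}. cyclotomic n j k')"
    unfolding eq by (simp only: bex_simps cc) (auto simp: c2)
qed

text \<open>Now \<open>{2..\<delta>}\<close> meets every coset except that of 0 and, if
  \<open>\<delta>\<close> is below the largest leader, that of -1. The dual zeros are the exponents
  0 and 1 up to conjugacy in the latter case, and 0 alone otherwise.\<close>

lemma dual_intervalsI_large:
  assumes "2 ^ (m - 1) - 2 ^ ((m - 1) div 2) - 1 \<le> \<delta>" "\<delta> \<le> n - 1"
  shows "dual_intervals n \<delta> n (if \<delta> < 2 ^ (m - 1) - 1 then 3 else 2)"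
  unfolding dual_intervals_def
proof (intro allI impI)
  note ne = n_plus_1_eqs and tp = two_power_ineqs
  fix k k' assume kk: "[k + k' = 0] (mod n)"
  have "2 ^ ((m - 1) div 2) + 3 \<le> (2::nat) ^ (m - 1)" using ne tp(1) by linarith
  then have \<delta>2: "2 \<le> \<delta>" using assms(1) by linarith
  have zero: "\<not> (\<exists>j\<in>{2..\<delta>}. cyclotomic n j k')" if "n dvd k"
  proof -
    have "n dvd k'" using that kk by (metis cong_0_iff dvd_add_right_iff)
    then have "cyclotomic n j 0" if "cyclotomic n j k'" for j
      using that cyclotomic_cong[of j j n k' 0] by (auto simp: cong_0_iff)
    then show ?thesis using assms ne by (force simp: cyclotomic_to_0 dest: dvd_imp_le)
  qed
  have rest: "\<exists>j\<in>{2..\<delta>}. cyclotomic n j k'" if nz: "\<not> n dvd k" "\<not> cyclotomic n 1 k"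
  proof -
    from kk obtain j where j: "1 \<le> j" "j \<le> 2 ^ (m - 1) - 2 ^ ((m - 1) div 2) - 1" "cyclotomic n j k'"
      by (rule cyclotomic_trichotomy) (use nz in auto)
    show ?thesis
    proof (cases "j = 1")
      \<comment> \<open>The value 1 is outside \<open>{2..\<delta>}\<close>, but 2 lies in the same
        coset.\<close>
      case True
      then have "cyclotomic n 2 k'" using j cyclotomic_2_1 cyclotomic_trans by blast
      then show ?thesis using \<delta>2 by auto
    next
      case False
      then show ?thesis using j assms by (intro bexI[of _ j]) auto
    qed
  qed
  have nk: "cyclotomic n n k \<longleftrightarrow> n dvd k"
    using cyclotomic_cong[of n 0 n k k] by (simp add: cong_def cyclotomic_0)
  show "(\<exists>j\<in>{n..n + (if \<delta> < 2 ^ (m - 1) - 1 then 3 else 2) - 2}. cyclotomic n j k)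
      \<noteq> (\<exists>j\<in>{2..\<delta>}. cyclotomic n j k')"
  proof (cases "\<delta> < 2 ^ (m - 1) - 1")
    case True
    have eq: "{n..n + (if \<delta> < 2 ^ (m - 1) - 1 then 3 else 2) - 2} = {n, n + 1}"
      using True by auto
    have n1: "cyclotomic n (n + 1) k \<longleftrightarrow> cyclotomic n 1 k"
      by (rule cyclotomic_cong) (simp_all only: cong_def mod_add_self1)
    have "\<not> (\<exists>j\<in>{2..\<delta>}. cyclotomic n j k')" if "cyclotomic n 1 k"
      using not_cyclotomic_small[OF kk that] True by force
    with zero rest True show ?thesis unfolding eq by (auto simp: nk n1[simplified])
  next
    case False
    have "\<exists>j\<in>{2..\<delta>}. cyclotomic n j k'" if "cyclotomic n 1 k"
    proof -
      have "cyclotomic n (n - 1) k'"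
        using that by (rule cyclotomic_uminus) (use kk ne in \<open>auto simp: cong_0_iff\<close>)
      moreover have "cyclotomic n (2 ^ (m - 1) - 1) (n - 1)"
      proof -
        have "n - 1 = (2 ^ (m - 1) - 1) * 2 ^ 1" using ne(1) by (simp add: diff_mult_distrib)
        then show ?thesis by (metis cyclotomic_mult_power)
      qed
      ultimately have "cyclotomic n (2 ^ (m - 1) - 1) k'" using cyclotomic_trans by blast
      moreover have "2 ^ (m - 1) - 1 \<in> {2..\<delta>}" using False ne(1,3,4) unfolding atLeastAtMost_iff by linarith
      ultimately show ?thesis by blast
    qed
    with zero rest False show ?thesis by (auto simp: nk)
  qed
qed

lemma ex_dual_intervals_iff:
  assumes "2 \<le> \<delta>" "\<delta> \<le> n"
  shows "(\<exists>b' \<delta>'. 1 \<le> b' \<and> 2 \<le> \<delta>' \<and> \<delta>' \<le> n \<and> dual_intervals n \<delta> b' \<delta>') \<longleftrightarrow>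
    \<delta> = 2 \<or> (2 ^ (m - 1) - 2 ^ ((m - 1) div 2) - 1 \<le> \<delta> \<and> \<delta> \<le> n - 1)"
    (is "?L \<longleftrightarrow> _ \<or> ?R")
proof -
  note ne = n_plus_1_eqs
  have ?L if "\<delta> = 2"
    using dual_intervalsI_2 that ne by (intro exI[of _ n] exI[of _ "2 ^ (m - 1)"]) auto
  moreover have ?L if ?R
    using dual_intervalsI_large[of \<delta>] that ne
    by (intro exI[of _ n] exI[of _ "if \<delta> < 2 ^ (m - 1) - 1 then 3 else 2"]) auto
  moreover have "\<delta> = 2 \<or> ?R" if ?L
    using that assms dual_intervalsD by (cases "\<delta> = 2") auto
  ultimately show ?thesis by blast
qed

end

section \<open>Codes as zero sets\<close>

text \<open>A constant of its own for the embedding of the prime field, to which the rewrite rules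
  below attach.\<close>

definition embed_bit :: "bit \<Rightarrow> 'a::field" where
  "embed_bit b = of_bit b"

lemma embed_bit_simps [simp]: "embed_bit 0 = 0" "embed_bit 1 = 1"
  by (simp_all add: embed_bit_def)

lemma embed_bit_eq_0_iff [simp]: "embed_bit b = 0 \<longleftrightarrow> b = 0"
  by (cases b) auto

lemma embed_bit_mult: "embed_bit (a * b) = embed_bit a * embed_bit b"
  by (cases a; cases b) auto

lemma embed_bit_power [simp]: "0 < k \<Longrightarrow> embed_bit b ^ k = embed_bit b"
  by (cases b) auto

definition bit_eval :: "bit poly \<Rightarrow> 'a::field \<Rightarrow> 'a" where
  "bit_eval p x = poly (map_poly embed_bit p) x"

lemma bit_eval_alt: "bit_eval p x = poly (map_poly of_bit p) x"
  unfolding bit_eval_def embed_bit_def ..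

lemma bit_eval_0 [simp]: "bit_eval 0 x = 0"
  by (simp add: bit_eval_def)

lemma bit_eval_pCons: "bit_eval (pCons a p) x = embed_bit a + x * bit_eval p x"
  by (simp add: bit_eval_def map_poly_pCons)

text \<open>The sum has \<open>n\<close> terms whatever the degree, so words of the same length can
  be combined termwise.\<close>

lemma bit_eval_words:
  assumes "p \<in> words n"
  shows "bit_eval p x = (\<Sum>i<n. embed_bit (coeff p i) * x ^ i)"
proof -
  have "degree (map_poly embed_bit p :: 'a poly) = degree p"
    by (cases "p = 0") (simp_all add: map_poly_degree_eq)
  then have "bit_eval p x = (\<Sum>i\<le>degree p. embed_bit (coeff p i) * x ^ i)"
    by (simp add: bit_eval_def poly_altdef coeff_map_poly)
  also have "\<dots> = (\<Sum>i<n. embed_bit (coeff p i) * x ^ i)"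
  proof (rule sum.mono_neutral_cong)
    show "embed_bit (coeff p i) * x ^ i = 0" if "i \<in> {..degree p} - {..<n}" for i
      using that assms by (simp add: words_def)
    show "embed_bit (coeff p i) * x ^ i = 0" if "i \<in> {..<n} - {..degree p}" for i
      using that by (simp add: coeff_eq_0)
  qed auto
  finally show ?thesis .
qed

section \<open>Arithmetic of the field with \<open>2 ^ m\<close> elements\<close>

context
  fixes m n :: nat
  assumes card: "CARD('a::{field,finite}) = 2 ^ m" and m_pos: "m \<ge> 1" and n_eq: "n = 2 ^ m - 1"
begin

text \<open>Translation by 1 permutes the field, so comparing sums over it shows that the prime
  characteristic divides \<open>2 ^ m\<close>.\<close>

lemma CHAR_2: "CHAR('a) = 2"
proof -
  have pr: "prime CHAR('a)"
    by (rule prime_CHAR_semidom) (simp add: finite_imp_CHAR_pos)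
  moreover have "CHAR('a) dvd 2 ^ m"
  proof -
    have "(\<Sum>x\<in>UNIV. x + 1 :: 'a) = (\<Sum>x\<in>UNIV. x)"
      by (rule sum.reindex_bij_witness[of _ "\<lambda>y. y - 1" "\<lambda>y. y + 1"]) auto
    then have "of_nat (2 ^ m) = (0 :: 'a)" by (simp add: sum.distrib card)
    then show ?thesis by (simp only: of_nat_eq_0_iff_char_dvd)
  qed
  ultimately have "CHAR('a) dvd 2" by (rule prime_dvd_power)
  with pr show ?thesis by (simp add: primes_dvd_imp_eq)
qed

lemma n_pos: "n > 0"
  using power_increasing[of 1 m "2::nat"] m_pos by (simp add: n_eq)

text \<open>Because of this, the factor \<open>n\<close> of Fourier inversion disappears from all
  formulas below.\<close>

lemma of_nat_n: "(of_nat n :: 'a) = 1"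
proof -
  have "(of_nat (n + 1) :: 'a) = of_nat (2 ^ m)" by (simp add: n_eq)
  also have "\<dots> = 0" using m_pos CHAR_2 by (subst of_nat_eq_0_iff_char_dvd) auto
  finally have "(of_nat n :: 'a) = - 1" by (simp add: eq_neg_iff_add_eq_0 add.commute)
  then show ?thesis using CHAR_2 uminus_CHAR_2[where ?'a = 'a] by simp
qed

text \<open>Multiplication by \<open>x\<close> permutes the nonzero elements; compare their
  products.\<close>

lemma power_n_eq_1:
  fixes x :: 'a
  assumes "x \<noteq> 0"
  shows "x ^ n = 1"
proof -
  have "(\<Prod>y\<in>UNIV-{0}. x * y) = x ^ n * \<Prod>(UNIV-{0})"
    by (simp add: prod.distrib card n_eq)
  moreover have "(\<Prod>y\<in>UNIV-{0}. x * y) = (\<Prod>y\<in>UNIV-{0}. y)"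
    by (rule prod.reindex_bij_witness[of _ "\<lambda>y. y / x" "\<lambda>y. x * y"]) (use assms in auto)
  moreover have "\<Prod>(UNIV-{0 :: 'a}) \<noteq> 0" by (subst prod_zero_iff) auto
  ultimately show ?thesis by simp
qed

lemma power_2_power_m: "x ^ 2 ^ m = (x :: 'a)"
proof (cases "x = 0")
  case False
  have "2 ^ m = Suc n" by (simp add: n_eq)
  then show ?thesis using power_n_eq_1[OF False] by simp
qed simp

lemma frobenius_sum: "(\<Sum>i\<in>A. f i :: 'a) ^ 2 ^ k = (\<Sum>i\<in>A. f i ^ 2 ^ k)"
  using freshmans_dream_sum'[of "2 ^ k" k f A] CHAR_2 by simp

lemma bit_eval_add: "bit_eval (p + q) (x :: 'a) = bit_eval p x + bit_eval q x"
  unfolding bit_eval_alt by (rule poly_of_bit_add[OF CHAR_2])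

lemma embed_bit_sum: "embed_bit (sum f A) = (\<Sum>i\<in>A. embed_bit (f i) :: 'a)"
proof (induction A rule: infinite_finite_induct)
  case (insert x F)
  have "embed_bit (f x + sum f F) = (embed_bit (f x) + embed_bit (sum f F) :: 'a)"
    unfolding embed_bit_def by (rule of_bit_add[OF CHAR_2])
  with insert show ?case by simp
qed simp_all

lemma bit_eval_mult: "bit_eval (p * q) (x :: 'a) = bit_eval p x * bit_eval q x"
proof (induction p)
  case (pCons a p)
  have smult: "bit_eval (smult a q) x = embed_bit a * bit_eval q x"
    by (cases a) auto
  show ?case
    by (simp add: bit_eval_add smult bit_eval_pCons pCons.IH distrib_right mult.assoc)
qed simp

lemma bit_eval_diff: "bit_eval (p - q) (x :: 'a) = bit_eval p x - bit_eval q x"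
  using bit_eval_add[of "p - q" q x] by (simp add: algebra_simps)

text \<open>Squaring fixes the coefficients, so the zeros of a binary polynomial form full conjugacy
  classes.\<close>

lemma bit_eval_frobenius: "bit_eval p (x ^ 2 ^ k) = bit_eval p (x :: 'a) ^ 2 ^ k"
proof -
  have w: "p \<in> words (Suc (degree p))" by (auto simp: words_def coeff_eq_0)
  show ?thesis
    by (simp add: bit_eval_words[OF w] frobenius_sum power_mult_distrib
        power_mult[symmetric] mult.commute del: lessThan_Suc sum.lessThan_Suc)
qed

text \<open>The remainder of \<open>f\<close> has the same value at \<open>x\<close>, and by
  minimality of the degree it can vanish there only if it is 0.\<close>

lemma min_poly_dvd_iff: "min_poly x dvd f \<longleftrightarrow> bit_eval f (x :: 'a) = 0"
proof -
  have mp: "lead_coeff (min_poly x) = 1" "bit_eval (min_poly x) x = 0"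
    "\<And>q. q \<noteq> 0 \<Longrightarrow> bit_eval q x = 0 \<Longrightarrow> degree (min_poly x) \<le> degree q"
    using is_min_poly_min_poly[OF CHAR_2, of x] by (auto simp: is_min_poly_def bit_eval_alt)
  show ?thesis
  proof
    assume "min_poly x dvd f"
    then show "bit_eval f x = 0" using mp(2) by (auto elim!: dvdE simp: bit_eval_mult)
  next
    assume f: "bit_eval f x = 0"
    have "f = f div min_poly x * min_poly x + f mod min_poly x" by simp
    then have "bit_eval f x = bit_eval (f mod min_poly x) x"
      by (metis bit_eval_add bit_eval_mult mp(2) mult_zero_right add_0)
    with f have r: "bit_eval (f mod min_poly x) x = 0" by simp
    have "min_poly x \<noteq> 0" using mp(1) by auto
    then have "f mod min_poly x = 0"
      using mp(3)[OF _ r] degree_mod_less'[of "min_poly x" f] by (metis leD)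
    then show "min_poly x dvd f" by (simp add: dvd_eq_mod_eq_0)
  qed
qed

definition zero_code :: "'a set \<Rightarrow> bit poly set" where
  "zero_code S = {f \<in> words n. \<forall>x\<in>S. bit_eval f x = 0}"

text \<open>The generator \<open>g\<close> divides \<open>f\<close> iff \<open>f\<close> vanishes at
  the listed powers. All nonzero elements are roots of \<open>N\<close>, so \<open>g\<close> divides
  \<open>N\<close> and reduction modulo \<open>N\<close> preserves divisibility by
  \<open>g\<close>.\<close>

lemma BCH_code_eq:
  fixes \<alpha> :: 'a
  assumes "\<alpha> \<noteq> 0"
  shows "BCH_code \<alpha> n \<delta> b = zero_code ((\<lambda>j. \<alpha> ^ j) ` {b..b + \<delta> - 2})"
proof -
  define g where "g = Lcm ((\<lambda>j. min_poly (\<alpha> ^ j)) ` {b..b + \<delta> - 2})"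
  have g: "g dvd f \<longleftrightarrow> (\<forall>x\<in>(\<lambda>j. \<alpha> ^ j) ` {b..b + \<delta> - 2}. bit_eval f x = 0)" for f
    by (simp add: g_def Lcm_dvd_iff min_poly_dvd_iff)
  define N where "N = (monom 1 n - 1 :: bit poly)"
  have "bit_eval N x = 0" if "x \<noteq> 0" for x :: 'a
    using power_n_eq_1[OF that] unfolding N_def bit_eval_diff
    by (simp add: bit_eval_def map_poly_monom poly_monom)
  then have gN: "g dvd N" using assms by (simp add: g)
  have "degree (monom 1 n + (- 1) :: bit poly) = degree (monom 1 n :: bit poly)"
    using n_pos by (intro degree_add_eq_left) (simp add: degree_monom_eq)
  then have degN: "degree N = n" by (simp add: N_def degree_monom_eq)
  then have N0: "N \<noteq> 0" using n_pos by auto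
  have words: "f \<in> words n \<longleftrightarrow> f mod N = f" for f
  proof
    assume f: "f \<in> words n"
    have "f = 0 \<or> degree f < n"
    proof (cases "degree f < n")
      case False
      then have "lead_coeff f = 0" using f by (simp only: words_def mem_Collect_eq not_less)
      then show ?thesis by simp
    qed simp
    then show "f mod N = f" using degN by (auto simp: mod_poly_less)
  next
    assume "f mod N = f"
    then have "f = 0 \<or> degree f < n" using degree_mod_less[OF N0, of f] degN by auto
    then show "f \<in> words n" by (auto simp: words_def coeff_eq_0)
  qed
  have "f \<in> cyclic_code n g \<longleftrightarrow> f \<in> words n \<and> g dvd f" for f
  proof
    assume "f \<in> cyclic_code n g"
    then obtain h where h: "f = (h * g) mod N" by (auto simp: cyclic_code_def N_def)
    then have "f mod N = f" by simp
    moreover have "g dvd f" unfolding h using gN by (simp add: dvd_mod)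
    ultimately show "f \<in> words n \<and> g dvd f" by (simp add: words)
  next
    assume f: "f \<in> words n \<and> g dvd f"
    then obtain h where "f = h * g" by (metis dvdE mult.commute)
    moreover have "f mod N = f" using f by (simp add: words)
    ultimately have "f = (h * g) mod N" by simp
    then show "f \<in> cyclic_code n g" unfolding cyclic_code_def N_def by blast
  qed
  then show ?thesis
    unfolding BCH_code_def zero_code_def g_def[symmetric] using g by blast
qed

section \<open>The absolute trace and words built from it\<close>

definition trace :: "'a \<Rightarrow> 'a" where
  "trace x = (\<Sum>j<m. x ^ 2 ^ j)"

text \<open>Squaring permutes the summands cyclically, by \<open>power_2_power_m\<close>.\<close>

lemma trace_square: "trace x ^ 2 = trace x"
proof -
  have "trace x ^ 2 = (\<Sum>j<m. x ^ 2 ^ Suc j)"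
    using frobenius_sum[of "\<lambda>j. x ^ 2 ^ j" "{..<m}" 1]
    by (simp add: trace_def power_mult[symmetric] mult.commute)
  also have "\<dots> = (\<Sum>j<Suc m. x ^ 2 ^ j) - x ^ 2 ^ 0" by (subst sum.lessThan_Suc_shift) simp
  also have "\<dots> = trace x" by (simp add: power_2_power_m trace_def)
  finally show ?thesis .
qed

lemma trace_cases: "trace x = 0 \<or> trace x = 1"
  using trace_square[of x] by (simp add: power2_eq_square)

text \<open>A nonzero linearized polynomial has degree at most \<open>2 ^ (m - 1)\<close>, too few roots to vanish
  on the whole field.\<close>

lemma ex_linearized_nonzero:
  assumes "J \<subseteq> {..<m}" "J \<noteq> {}"
  shows "\<exists>\<beta>::'a. (\<Sum>j\<in>J. \<beta> ^ 2 ^ j) \<noteq> 0"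
proof (rule ccontr)
  assume "\<not> ?thesis"
  then have zero: "(\<Sum>j\<in>J. \<beta> ^ 2 ^ j) = 0" for \<beta> :: 'a by blast
  have fin: "finite J" using assms(1) finite_subset by blast
  define p :: "'a poly" where "p = (\<Sum>j\<in>J. monom 1 (2 ^ j))"
  obtain j0 where j0: "j0 \<in> J" using assms by blast
  have "coeff p (2 ^ j0) = (\<Sum>j\<in>J. if j = j0 then 1 else 0)"
    unfolding p_def coeff_sum by (intro sum.cong) auto
  also have "\<dots> = 1" using j0 fin by simp
  finally have p0: "p \<noteq> 0" by auto
  have "degree p \<le> 2 ^ (m - 1)"
    unfolding p_def
  proof (rule degree_sum_le[OF fin])
    fix j assume "j \<in> J"
    then have "(2::nat) ^ j \<le> 2 ^ (m - 1)" using assms(1) by (intro power_increasing) auto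
    then show "degree (monom 1 (2 ^ j) :: 'a poly) \<le> 2 ^ (m - 1)" by (simp add: degree_monom_eq)
  qed
  moreover have "card {x. poly p x = 0} = 2 ^ m"
    using zero card by (simp add: p_def poly_sum poly_monom)
  ultimately have "(2::nat) ^ m \<le> 2 ^ (m - 1)"
    using card_poly_roots_bound[OF p0] by linarith
  moreover have "(2::nat) ^ (m - 1) < 2 ^ m" using m_pos by (intro power_strict_increasing) auto
  ultimately show False by linarith
qed

lemma sum_powers_eq:
  assumes "z \<noteq> (0::'a)"
  shows "(\<Sum>i<n. z ^ i) = (if z = 1 then 1 else 0)"
  using geometric_sum[of z n] power_n_eq_1[OF assms] of_nat_n by auto

text \<open>For nonzero \<open>x\<close>, this is the trace representation of an irreducible cyclic
  code. Traces are 0 or 1 in the field, and the conditional carries them back to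
  \<open>bit\<close>.\<close>

definition trace_word :: "'a \<Rightarrow> 'a \<Rightarrow> bit poly" where
  "trace_word x \<beta> = Poly (map (\<lambda>i. if trace (\<beta> * x ^ i) = 0 then 0 else 1) [0..<n])"

lemma trace_word_words: "trace_word x \<beta> \<in> words n"
  by (auto simp: trace_word_def words_def nth_default_def)

lemma embed_coeff_trace_word:
  "i < n \<Longrightarrow> embed_bit (coeff (trace_word x \<beta>) i) = trace (\<beta> * x ^ i)"
  using trace_cases[of "\<beta> * x ^ i"] by (auto simp: trace_word_def nth_default_def)

text \<open>Expanding the trace leaves geometric sums, of which only those with ratio 1 survive. The
  value is thus 0 unless \<open>y\<close> is conjugate to \<open>inverse x\<close>, and otherwise a
  linearized polynomial in \<open>\<beta>\<close>.\<close>

lemma bit_eval_trace_word: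
  assumes "x \<noteq> 0" "y \<noteq> 0"
  shows "bit_eval (trace_word x \<beta>) y = (\<Sum>j | j < m \<and> x ^ 2 ^ j * y = 1. \<beta> ^ 2 ^ j)"
proof -
  have "bit_eval (trace_word x \<beta>) y = (\<Sum>i<n. trace (\<beta> * x ^ i) * y ^ i)"
    by (simp add: bit_eval_words[OF trace_word_words] embed_coeff_trace_word)
  also have "\<dots> = (\<Sum>i<n. \<Sum>j<m. \<beta> ^ 2 ^ j * (x ^ 2 ^ j * y) ^ i)"
    unfolding trace_def sum_distrib_right
    by (intro sum.cong refl) (simp add: power_mult_distrib power_mult[symmetric] mult_ac)
  also have "\<dots> = (\<Sum>j<m. \<beta> ^ 2 ^ j * (\<Sum>i<n. (x ^ 2 ^ j * y) ^ i))"
    by (subst sum.swap) (simp add: sum_distrib_left)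
  also have "\<dots> = (\<Sum>j<m. if x ^ 2 ^ j * y = 1 then \<beta> ^ 2 ^ j else 0)"
    by (intro sum.cong refl) (use assms in \<open>simp add: sum_powers_eq\<close>)
  also have "\<dots> = (\<Sum>j | j < m \<and> x ^ 2 ^ j * y = 1. \<beta> ^ 2 ^ j)"
    by (subst sum.inter_filter[symmetric]) auto
  finally show ?thesis .
qed

lemma embed_inner_prod:
  "embed_bit (inner_prod n u v) = (\<Sum>i<n. embed_bit (coeff u i) * embed_bit (coeff v i) :: 'a)"
  unfolding inner_prod_def embed_bit_sum embed_bit_mult ..

text \<open>The entries of \<open>v\<close> are fixed by squaring, so they can be moved inside the
  trace, which is additive.\<close>

lemma embed_inner_prod_trace_word:
  assumes "v \<in> words n"
  shows "embed_bit (inner_prod n (trace_word x \<beta>) v) = trace (\<beta> * bit_eval v x)"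
proof -
  have bb: "(embed_bit b :: 'a) ^ 2 ^ j = embed_bit b" for b and j :: nat by simp
  have "embed_bit (inner_prod n (trace_word x \<beta>) v) = (\<Sum>i<n. trace (\<beta> * x ^ i) * embed_bit (coeff v i))"
    by (simp add: embed_inner_prod embed_coeff_trace_word)
  also have "\<dots> = (\<Sum>j<m. \<Sum>i<n. (\<beta> * (embed_bit (coeff v i) * x ^ i)) ^ 2 ^ j)"
    unfolding trace_def sum_distrib_right
    by (subst sum.swap) (intro sum.cong refl, simp only: power_mult_distrib bb mult_ac)
  also have "\<dots> = trace (\<beta> * bit_eval v x)"
    unfolding trace_def bit_eval_words[OF assms] sum_distrib_left frobenius_sum ..
  finally show ?thesis .
qed

section \<open>Parseval's identity and duals of codes given by zeros\<close>

lemma generator_nonzero: "unit_group_generator (\<alpha> :: 'a) \<Longrightarrow> \<alpha> \<noteq> 0"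
  unfolding unit_group_generator_def by (metis Diff_iff insertI1 power_one_right rangeI)

text \<open>Exponents below \<open>n\<close> already yield all \<open>n\<close> nonzero elements, so
  counting makes these powers distinct.\<close>

lemma generator_power_eq_iff:
  assumes "unit_group_generator (\<alpha> :: 'a)"
  shows "\<alpha> ^ i = \<alpha> ^ l \<longleftrightarrow> [i = l] (mod n)"
proof -
  have gen: "range (\<lambda>k::nat. \<alpha> ^ k) = UNIV - {0}" using assms by (simp add: unit_group_generator_def)
  have red: "\<alpha> ^ k = \<alpha> ^ (k mod n)" for k
    by (metis div_mult_mod_eq power_add power_mult power_n_eq_1[OF generator_nonzero[OF assms]]
        power_one mult_1 mult.commute)
  have less: "k mod n < n" for k using n_pos by simp
  have "range (\<lambda>k::nat. \<alpha> ^ k) = (\<lambda>k. \<alpha> ^ k) ` {..<n}"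
    using red less by (auto intro!: image_eqI[of _ _ "_ mod n"])
  then have "card ((\<lambda>k. \<alpha> ^ k) ` {..<n}) = card (UNIV - {0::'a})"
    by (simp only: gen)
  also have "\<dots> = card {..<n}" using card by (simp add: n_eq card_Diff_singleton)
  finally have "inj_on (\<lambda>k. \<alpha> ^ k) {..<n}" by (intro eq_card_imp_inj_on) simp_all
  then have "\<alpha> ^ (i mod n) = \<alpha> ^ (l mod n) \<longleftrightarrow> i mod n = l mod n"
    using less by (auto simp: inj_on_eq_iff)
  then show ?thesis using red by (metis cong_def)
qed

text \<open>For \<open>i \<noteq> l\<close>, replacing \<open>x\<close> by
  \<open>\<alpha> * x\<close> multiplies the sum by a factor other than 1, so it vanishes.\<close>

lemma sum_unit_powers:
  assumes "unit_group_generator (\<alpha> :: 'a)" "i < n" "l < n"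
  shows "(\<Sum>x\<in>UNIV-{0::'a}. x ^ i * inverse x ^ l) = (if i = l then 1 else 0)"
proof (cases "i = l")
  case True
  have "(\<Sum>x\<in>UNIV-{0::'a}. x ^ i * inverse x ^ l) = (\<Sum>x\<in>UNIV-{0::'a}. 1)"
    using True by (intro sum.cong) (auto simp: power_inverse)
  then show ?thesis using True of_nat_n card by (simp add: n_eq)
next
  case False
  have \<alpha>0: "\<alpha> \<noteq> 0" using generator_nonzero[OF assms(1)] .
  have ne: "\<alpha> ^ i \<noteq> \<alpha> ^ l"
    using False assms by (simp add: generator_power_eq_iff[OF assms(1)] cong_def)
  define s where "s = (\<Sum>x\<in>UNIV-{0::'a}. x ^ i * inverse x ^ l)"
  have "s = (\<Sum>x\<in>UNIV-{0::'a}. (\<alpha> * x) ^ i * inverse (\<alpha> * x) ^ l)"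
    unfolding s_def
    by (rule sum.reindex_bij_witness[of _ "\<lambda>y. \<alpha> * y" "\<lambda>y. y / \<alpha>"]) (use \<alpha>0 in auto)
  also have "\<dots> = \<alpha> ^ i * inverse \<alpha> ^ l * s"
    unfolding s_def sum_distrib_left by (intro sum.cong) (auto simp: power_mult_distrib)
  finally have "s * \<alpha> ^ l = \<alpha> ^ i * s"
    using \<alpha>0 by (simp add: power_inverse field_simps)
  then have "s * (\<alpha> ^ l - \<alpha> ^ i) = 0" by (simp add: algebra_simps)
  then show ?thesis using ne False by (simp add: s_def)
qed

lemma parseval:
  assumes "unit_group_generator (\<alpha> :: 'a)" "u \<in> words n" "v \<in> words n"
  shows "embed_bit (inner_prod n u v) = (\<Sum>x\<in>UNIV-{0::'a}. bit_eval u x * bit_eval v (inverse x))"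
proof -
  have "(\<Sum>x\<in>UNIV-{0::'a}. bit_eval u x * bit_eval v (inverse x)) =
      (\<Sum>x\<in>UNIV-{0::'a}. \<Sum>i<n. \<Sum>l<n. embed_bit (coeff u i) * embed_bit (coeff v l) * (x ^ i * inverse x ^ l))"
    unfolding bit_eval_words[OF assms(2)] bit_eval_words[OF assms(3)] sum_product
    by (intro sum.cong refl) (simp only: mult_ac)
  also have "\<dots> = (\<Sum>i<n. \<Sum>l<n. embed_bit (coeff u i) * embed_bit (coeff v l) *
      (\<Sum>x\<in>UNIV-{0::'a}. x ^ i * inverse x ^ l))"
    unfolding sum_distrib_left by (subst sum.swap, intro sum.cong refl, rule sum.swap)
  also have "\<dots> = (\<Sum>i<n. \<Sum>l<n. if i = l then embed_bit (coeff u i) * embed_bit (coeff v l) else 0)"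
    by (intro sum.cong refl) (simp add: sum_unit_powers[OF assms(1)])
  also have "\<dots> = embed_bit (inner_prod n u v)"
    by (simp add: embed_inner_prod)
  finally show ?thesis ..
qed

text \<open>If \<open>y\<close> in \<open>T\<close> is conjugate to nothing in \<open>S\<close>, a
  trace word for \<open>inverse y\<close> vanishes on \<open>S\<close> but, with suitable
  \<open>\<beta>\<close>, not at \<open>y\<close>. The converse is invariance under
  Frobenius.\<close>

lemma zero_code_subset_iff:
  fixes S T :: "'a set"
  assumes "0 \<notin> S" "0 \<notin> T"
  shows "zero_code S \<subseteq> zero_code T \<longleftrightarrow> (\<forall>y\<in>T. \<exists>x\<in>S. \<exists>j. y = x ^ 2 ^ j)"
proof
  assume sub: "zero_code S \<subseteq> zero_code T"
  show "\<forall>y\<in>T. \<exists>x\<in>S. \<exists>j. y = x ^ 2 ^ j"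
  proof (rule ballI, rule ccontr)
    fix y assume y: "y \<in> T" and no: "\<not> (\<exists>x\<in>S. \<exists>j. y = x ^ 2 ^ j)"
    have y0: "y \<noteq> 0" using y assms by auto
    \<comment> \<open>These are the powers of Frobenius that fix \<open>y\<close>. There are several
      if \<open>y\<close> lies in a proper subfield, hence the need for
      \<open>ex_linearized_nonzero\<close>.\<close>
    define J where "J = {j. j < m \<and> inverse y ^ 2 ^ j * y = 1}"
    have "0 \<in> J" using y0 m_pos by (simp add: J_def)
    moreover have "J \<subseteq> {..<m}" by (auto simp: J_def)
    ultimately obtain \<beta> :: 'a where \<beta>: "(\<Sum>j\<in>J. \<beta> ^ 2 ^ j) \<noteq> 0"
      using ex_linearized_nonzero[of J] by blast
    have "bit_eval (trace_word (inverse y) \<beta>) x = 0" if "x \<in> S" for x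
    proof -
      have "inverse y ^ 2 ^ j * x \<noteq> 1" if j: "j < m" for j
      proof
        assume "inverse y ^ 2 ^ j * x = 1"
        then have x: "x = y ^ 2 ^ j" using y0 by (simp add: power_inverse field_simps)
        have "x ^ 2 ^ (m - j) = y ^ 2 ^ m"
          using j unfolding x by (simp flip: power_mult power_add)
        then have "y = x ^ 2 ^ (m - j)" by (simp add: power_2_power_m)
        then show False using no \<open>x \<in> S\<close> by blast
      qed
      then have "{j. j < m \<and> inverse y ^ 2 ^ j * x = 1} = {}" by blast
      moreover have "x \<noteq> 0" using that assms by auto
      ultimately show ?thesis using y0 by (simp only: bit_eval_trace_word nonzero_imp_inverse_nonzero sum.empty not_False_eq_True)
    qed
    then have "trace_word (inverse y) \<beta> \<in> zero_code T"
      using subsetD[OF sub, of "trace_word (inverse y) \<beta>"] trace_word_words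
      by (simp add: zero_code_def)
    then have "bit_eval (trace_word (inverse y) \<beta>) y = 0" using y by (simp add: zero_code_def)
    then show False using \<beta> y0 by (simp add: bit_eval_trace_word J_def)
  qed
next
  assume *: "\<forall>y\<in>T. \<exists>x\<in>S. \<exists>j. y = x ^ 2 ^ j"
  show "zero_code S \<subseteq> zero_code T"
  proof
    fix f assume f: "f \<in> zero_code S"
    have "bit_eval f y = 0" if y: "y \<in> T" for y
    proof -
      obtain x j where "x \<in> S" "y = x ^ 2 ^ j" using * y by blast
      with f show ?thesis by (simp add: zero_code_def bit_eval_frobenius)
    qed
    with f show "f \<in> zero_code T" by (simp add: zero_code_def)
  qed
qed

lemma dual_zero_code:
  fixes S :: "'a set"
  assumes gen: "unit_group_generator (\<alpha> :: 'a)" and S: "0 \<notin> S"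
  shows "dual_code n (zero_code S) =
    zero_code {y. y \<noteq> 0 \<and> \<not> (\<exists>x\<in>S. \<exists>j. inverse y = x ^ 2 ^ j)}" (is "_ = zero_code ?N")
proof (intro equalityI subsetI)
  fix v assume v: "v \<in> dual_code n (zero_code S)"
  then have vw: "v \<in> words n" by (simp add: dual_code_def)
  have "bit_eval v y = 0" if y: "y \<in> ?N" for y
  proof (rule ccontr)
    assume ne: "bit_eval v y \<noteq> 0"
    have "{..<m} \<noteq> {}" using m_pos by (auto simp: lessThan_empty_iff)
    then obtain \<gamma> :: 'a where "trace \<gamma> \<noteq> 0"
      using ex_linearized_nonzero[of "{..<m}"] unfolding trace_def by blast
    \<comment> \<open>The scaling makes the pairing of the trace word with \<open>v\<close> equal to
      \<open>trace \<gamma>\<close>.\<close>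
    moreover define \<beta> where "\<beta> = \<gamma> / bit_eval v y"
    ultimately have \<beta>: "trace (\<beta> * bit_eval v y) \<noteq> 0" using ne by simp
    have "trace_word y \<beta> \<in> zero_code S"
    proof -
      have "bit_eval (trace_word y \<beta>) x = 0" if "x \<in> S" for x
      proof -
        have x0: "x \<noteq> 0" using that S by auto
        have "y ^ 2 ^ j * x \<noteq> 1" if j: "j < m" for j
        proof
          assume "y ^ 2 ^ j * x = 1"
          then have x: "x = inverse y ^ 2 ^ j" using y by (simp add: power_inverse field_simps)
          have "x ^ 2 ^ (m - j) = inverse y ^ 2 ^ m"
            using j unfolding x by (simp flip: power_mult power_add)
          then have "inverse y = x ^ 2 ^ (m - j)" by (simp add: power_2_power_m)
          then show False using y \<open>x \<in> S\<close> by blast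
        qed
        then have "{j. j < m \<and> y ^ 2 ^ j * x = 1} = {}" by blast
        moreover have "y \<noteq> 0" using y by simp
        ultimately show ?thesis using x0 by (simp only: bit_eval_trace_word sum.empty not_False_eq_True)
      qed
      then show ?thesis using trace_word_words by (simp add: zero_code_def)
    qed
    then have "inner_prod n (trace_word y \<beta>) v = 0" using v by (simp add: dual_code_def)
    then show False using \<beta> embed_inner_prod_trace_word[OF vw, of y \<beta>] by simp
  qed
  with vw show "v \<in> zero_code ?N" by (simp add: zero_code_def)
next
  fix v assume v: "v \<in> zero_code ?N"
  then have vw: "v \<in> words n" by (simp add: zero_code_def)
  have "inner_prod n u v = 0" if u: "u \<in> zero_code S" for u
  proof -
    \<comment> \<open>Each Parseval term has a vanishing factor: \<open>x\<close> is conjugate to an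
      element of \<open>S\<close>, or \<open>inverse x\<close> lies in \<open>?N\<close>.\<close>
    have "bit_eval u x * bit_eval v (inverse x) = 0" if x: "x \<in> UNIV - {0}" for x :: 'a
    proof (cases "\<exists>z\<in>S. \<exists>j. x = z ^ 2 ^ j")
      case True
      then show ?thesis using u by (auto simp: zero_code_def bit_eval_frobenius)
    next
      case False
      then have "inverse x \<in> ?N" using x by simp
      then show ?thesis using v by (simp add: zero_code_def)
    qed
    then have "(\<Sum>x\<in>UNIV - {0}. bit_eval u x * bit_eval v (inverse x)) = (0 :: 'a)"
      by (rule sum.neutral[OF ballI])
    then have "(embed_bit (inner_prod n u v) :: 'a) = 0"
      using parseval[OF gen _ vw, of u] u by (simp add: zero_code_def)
    then show ?thesis by simp
  qed
  with vw show "v \<in> dual_code n (zero_code S)" by (simp add: dual_code_def)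
qed

text \<open>The zero set \<open>N\<close> of the dual is closed under conjugation, so the codes
  agree iff the conjugates of \<open>T\<close> are exactly the elements of \<open>N\<close>.\<close>

lemma dual_zero_code_eq_iff:
  fixes S T :: "'a set"
  assumes gen: "unit_group_generator (\<alpha> :: 'a)" and S: "0 \<notin> S" and T: "0 \<notin> T"
  shows "dual_code n (zero_code S) = zero_code T \<longleftrightarrow>
    (\<forall>y. y \<noteq> 0 \<longrightarrow> (\<exists>x\<in>T. \<exists>j. y = x ^ 2 ^ j) \<noteq> (\<exists>x\<in>S. \<exists>j. inverse y = x ^ 2 ^ j))"
proof -
  define N where "N = {y. y \<noteq> 0 \<and> \<not> (\<exists>x\<in>S. \<exists>j. inverse y = x ^ 2 ^ j)}"
  have N0: "0 \<notin> N" by (simp add: N_def)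
  have closed: "y \<in> N" if y: "y ^ 2 ^ j \<in> N" for y j
  proof -
    have "y \<noteq> 0" using y by (auto simp: N_def zero_power)
    moreover have "\<not> inverse y = x ^ 2 ^ i" if "x \<in> S" for x i
    proof
      assume "inverse y = x ^ 2 ^ i"
      then have "inverse (y ^ 2 ^ j) = x ^ 2 ^ (i + j)"
        by (simp add: power_inverse[symmetric] power_add power_mult)
      then show False using y that unfolding N_def by blast
    qed
    ultimately show ?thesis by (auto simp: N_def)
  qed
  have closed': "y ^ 2 ^ j \<in> N" if y: "y \<in> N" for y j
  proof -
    \<comment> \<open>The two Frobenius exponents add up to a multiple of \<open>m\<close>. The
      factor \<open>j + 1\<close> keeps the difference from being truncated when \<open>j\<close>
      exceeds \<open>m\<close>.\<close>
    have "y = (y ^ 2 ^ j) ^ 2 ^ (m * (j + 1) - j)"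
    proof -
      have pm: "z ^ 2 ^ (m * k) = z" for z :: 'a and k
        by (induction k) (simp_all add: power_add power_mult power_2_power_m)
      have "j \<le> m * (j + 1)" using m_pos by (cases m) auto
      then have "(y ^ 2 ^ j) ^ 2 ^ (m * (j + 1) - j) = y ^ 2 ^ (m * (j + 1))"
        by (simp flip: power_mult power_add)
      then show ?thesis by (simp only: pm)
    qed
    with y show ?thesis using closed by metis
  qed
  have "dual_code n (zero_code S) = zero_code T \<longleftrightarrow> zero_code N \<subseteq> zero_code T \<and> zero_code T \<subseteq> zero_code N"
    unfolding dual_zero_code[OF gen S] N_def by blast
  also have "\<dots> \<longleftrightarrow> (\<forall>y\<in>T. y \<in> N) \<and> (\<forall>y\<in>N. \<exists>x\<in>T. \<exists>j. y = x ^ 2 ^ j)"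
  proof -
    have "(\<exists>x\<in>N. \<exists>j. y = x ^ 2 ^ j) \<longleftrightarrow> y \<in> N" for y
      using closed' by (metis power_0 power_one_right)
    then show ?thesis unfolding zero_code_subset_iff[OF N0 T] zero_code_subset_iff[OF T N0] by simp
  qed
  also have "\<dots> \<longleftrightarrow> (\<forall>y. y \<noteq> 0 \<longrightarrow> ((\<exists>x\<in>T. \<exists>j. y = x ^ 2 ^ j) \<longleftrightarrow> y \<in> N))"
    (is "_ \<longleftrightarrow> ?R")
  proof
    assume "(\<forall>y\<in>T. y \<in> N) \<and> (\<forall>y\<in>N. \<exists>x\<in>T. \<exists>j. y = x ^ 2 ^ j)"
    then show ?R using closed' by blast
  next
    assume R: ?R
    have "y \<in> N" if "y \<in> T" for y
    proof -
      have "y \<noteq> 0" using that T by auto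
      moreover have "\<exists>x\<in>T. \<exists>j. y = x ^ 2 ^ j"
        using that by (intro bexI[of _ y] exI[of _ 0]) simp_all
      ultimately show ?thesis using R by blast
    qed
    moreover have "\<exists>x\<in>T. \<exists>j. y = x ^ 2 ^ j" if "y \<in> N" for y
    proof -
      have "y \<noteq> 0" using that N0 by auto
      with that R show ?thesis by blast
    qed
    ultimately show "(\<forall>y\<in>T. y \<in> N) \<and> (\<forall>y\<in>N. \<exists>x\<in>T. \<exists>j. y = x ^ 2 ^ j)" by blast
  qed
  also have "\<dots> \<longleftrightarrow> (\<forall>y. y \<noteq> 0 \<longrightarrow>
      (\<exists>x\<in>T. \<exists>j. y = x ^ 2 ^ j) \<noteq> (\<exists>x\<in>S. \<exists>j. inverse y = x ^ 2 ^ j))"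
    by (auto simp: N_def)
  finally show ?thesis .
qed

text \<open>Taking logarithms to base \<open>\<alpha>\<close> turns inversion into negation modulo
  \<open>n\<close> and conjugacy into \<open>cyclotomic\<close>.\<close>

lemma dual_BCH_code_eq_iff:
  assumes gen: "unit_group_generator (\<alpha> :: 'a)"
  shows "dual_code n (BCH_code \<alpha> n \<delta> b) = BCH_code \<alpha> n \<delta>' b' \<longleftrightarrow>
    (\<forall>k k'. [k + k' = 0] (mod n) \<longrightarrow>
      (\<exists>j\<in>{b'..b' + \<delta>' - 2}. cyclotomic n j k) \<noteq> (\<exists>j\<in>{b..b + \<delta> - 2}. cyclotomic n j k'))"
proof -
  note \<alpha>0 = generator_nonzero[OF gen]
  have coset: "(\<exists>i. \<alpha> ^ k = (\<alpha> ^ j) ^ 2 ^ i) \<longleftrightarrow> cyclotomic n j k" for j k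
    by (simp add: cyclotomic_def generator_power_eq_iff[OF gen] flip: power_mult)
  have inv: "inverse (\<alpha> ^ k) = \<alpha> ^ k'" if "[k + k' = 0] (mod n)" for k k'
  proof -
    have "\<alpha> ^ (k + k') = \<alpha> ^ 0" using that by (simp only: generator_power_eq_iff[OF gen])
    then have "\<alpha> ^ k * \<alpha> ^ k' = 1" by (simp add: power_add)
    then show ?thesis by (rule inverse_unique)
  qed
  have ex_neg: "\<exists>k'. [k + k' = 0] (mod n)" for k
  proof -
    have "k + (n - 1) * k = n * k" using n_pos by (cases n) auto
    then show ?thesis by (intro exI[of _ "(n - 1) * k"]) (simp add: cong_0_iff)
  qed
  have nz: "0 \<notin> (\<lambda>j. \<alpha> ^ j) ` A" for A 
    unfolding image_iff using \<alpha>0 by (metis power_not_zero)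
  have ex_log: "\<exists>k. y = \<alpha> ^ k" if "y \<noteq> 0" for y :: 'a
  proof -
    have "y \<in> range (\<lambda>k::nat. \<alpha> ^ k)" using gen that by (simp add: unit_group_generator_def)
    then show ?thesis by blast
  qed
  have "dual_code n (BCH_code \<alpha> n \<delta> b) = BCH_code \<alpha> n \<delta>' b' \<longleftrightarrow>
    (\<forall>y. y \<noteq> 0 \<longrightarrow> (\<exists>j\<in>{b'..b' + \<delta>' - 2}. \<exists>i. y = (\<alpha> ^ j) ^ 2 ^ i) \<noteq>
      (\<exists>j\<in>{b..b + \<delta> - 2}. \<exists>i. inverse y = (\<alpha> ^ j) ^ 2 ^ i))"
    unfolding BCH_code_eq[OF \<alpha>0] dual_zero_code_eq_iff[OF gen nz nz] by (simp only: bex_simps)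
  also have "\<dots> \<longleftrightarrow> (\<forall>k k'. [k + k' = 0] (mod n) \<longrightarrow>
      (\<exists>j\<in>{b'..b' + \<delta>' - 2}. \<exists>i. \<alpha> ^ k = (\<alpha> ^ j) ^ 2 ^ i) \<noteq>
      (\<exists>j\<in>{b..b + \<delta> - 2}. \<exists>i. \<alpha> ^ k' = (\<alpha> ^ j) ^ 2 ^ i))"
    (is "(\<forall>y. y \<noteq> 0 \<longrightarrow> ?P y (inverse y)) \<longleftrightarrow> (\<forall>k k'. _ \<longrightarrow> ?P (\<alpha> ^ k) (\<alpha> ^ k'))")
  proof (intro iffI allI impI)
    fix k k' assume P: "\<forall>y. y \<noteq> 0 \<longrightarrow> ?P y (inverse y)" and kk: "[k + k' = 0] (mod n)"
    have "?P (\<alpha> ^ k) (inverse (\<alpha> ^ k))" using P[rule_format, of "\<alpha> ^ k"] \<alpha>0 by simp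
    then show "?P (\<alpha> ^ k) (\<alpha> ^ k')" unfolding inv[OF kk] .
  next
    fix y :: 'a assume P: "\<forall>k k'. [k + k' = 0] (mod n) \<longrightarrow> ?P (\<alpha> ^ k) (\<alpha> ^ k')" and "y \<noteq> 0"
    then obtain k where y: "y = \<alpha> ^ k" using ex_log by blast
    obtain k' where kk: "[k + k' = 0] (mod n)" using ex_neg by blast
    from P[rule_format, OF kk] show "?P y (inverse y)" unfolding y inv[OF kk] .
  qed
  finally show ?thesis unfolding coset .
qed

end

theorem theorem13:
  fixes \<alpha> :: "'a::{field,finite}" and m n \<delta> :: nat
  assumes "CARD('a) = 2 ^ m"
    and "unit_group_generator \<alpha>"
    and "m \<ge> 6"
    and "n = 2 ^ m - 1"
    and "2 \<le> \<delta>" and "\<delta> \<le> n"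
  shows "dually_BCH \<alpha> n (BCH_code \<alpha> n \<delta> 2) \<longleftrightarrow>
    \<delta> = 2 \<or> (2 ^ (m - 1) - 2 ^ ((m - 1) div 2) - 1 \<le> \<delta> \<and> \<delta> \<le> n - 1)"
proof -
  have "1 \<le> m" using assms(3) by simp
  \<comment> \<open>With \<open>b = 2\<close> the defining interval
    \<open>{b..b + \<delta> - 2}\<close> is \<open>{2..\<delta>}\<close>.\<close>
  have "dual_code n (BCH_code \<alpha> n \<delta> 2) = BCH_code \<alpha> n \<delta>' b' \<longleftrightarrow> dual_intervals n \<delta> b' \<delta>'" for b' \<delta>'
    unfolding dual_BCH_code_eq_iff[OF assms(1) \<open>1 \<le> m\<close> assms(4,2)] dual_intervals_def
    by simp
  then show ?thesis
    unfolding dually_BCH_def using ex_dual_intervals_iff[OF assms(4,3,5,6)] by simp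
qed

end
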